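(* Consider $G\ge 2$ treatment levels with potential outcomes $Y(1),\dots,Y(G)$, assignment indicators $\mathbf{W}=(W_1,\dots,W_G)$ (each $W_g\in\{0,1\}$, $\sum_g W_g=1$) with $\rho_g=\mathbb{P}(W_g=1)>0$, and covariates $\mathbf{X}$ ($1\times K$). Assume $\mathbf{W}$ is independent of $(Y(1),\dots,Y(G),\mathbf{X})$, the data $\{(\mathbf{W}_i,Y_i(1),\dots,Y_i(G),\mathbf{X}_i)\}_{i=1}^N$ are i.i.d., and second moments are finite; observed $Y_i=\sum_g W_{ig}Y_i(g)$. Let $\hat{\boldsymbol\mu}_{SM}=(\bar Y_1,\dots,\bar Y_G)'$ be the vector of subsample means $\bar Y_g=N_g^{-1}\sum_i W_{ig}Y_i$ ($N_g=\sum_iW_{ig}$), and let $\hat{\boldsymbol\mu}_{SRA}=(\hat\mu_1,\dots,\hat\mu_G)'$ with $\hat\mu_g=\hat\alpha_g+\bar{\mathbf{X}}\hat{\boldsymbol\beta}_g$, where $(\hat\alpha_g,\hat{\boldsymbol\beta}_g)$ are OLS intercept and slopes from regressing $Y_i$ on $1,\mathbf{X}_i$ among units with $W_{ig}=1$ and $\bar{\mathbf{X}}=N^{-1}\sum_i\mathbf{X}_i$. Then $$\mathrm{Avar}[\sqrt N(\hat{\boldsymbol\mu}_{SM}-\boldsymbol\mu)]-\mathrm{Avar}[\sqrt N(\hat{\boldsymbol\mu}_{SRA}-\boldsymbol\mu)]=\boldsymbol\Omega_{\mathbf{L}}-\boldsymbol\Omega_{\mathbf{K}},$$ and this matrix is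 positive semidefinite.
   Context: $\mu_g=\mathbb{E}[Y(g)]$, $\boldsymbol\mu=(\mu_1,\dots,\mu_G)'$, $\dot{\mathbf{X}}=\mathbf{X}-\mathbb{E}(\mathbf{X})$, $\boldsymbol\beta_g$ is the coefficient vector of the population linear projection of $Y(g)-\mu_g$ onto $\dot{\mathbf{X}}$. $\mathbf{L}_i$ is the $G\times 1$ vector with $g$-th entry $W_{ig}\dot{\mathbf{X}}_i\boldsymbol\beta_g/\rho_g$, $\mathbf{K}_i$ is the $G\times1$ vector with $g$-th entry $\dot{\mathbf{X}}_i\boldsymbol\beta_g$, $\boldsymbol\Omega_{\mathbf{L}}=\mathbb{E}(\mathbf{L}_i\mathbf{L}_i')$, $\boldsymbol\Omega_{\mathbf{K}}=\mathbb{E}(\mathbf{K}_i\mathbf{K}_i')$. $\mathrm{Avar}$ denotes the variance matrix of the limiting normal distribution. *)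

theory Defs
  imports "HOL-Probability.Probability"
begin

definition conv_in_distr ::
  "'a measure \<Rightarrow> (nat \<Rightarrow> 'a \<Rightarrow> real ^ 'g) \<Rightarrow> (real ^ 'g) measure \<Rightarrow> bool" where
  "conv_in_distr M Z Q \<longleftrightarrow>
     (\<forall>n. Z n \<in> borel_measurable M) \<and>
     (\<forall>f :: real ^ 'g \<Rightarrow> real. continuous_on UNIV f \<and> bounded (range f) \<longrightarrow>
        (\<lambda>n. integral\<^sup>L M (\<lambda>\<omega>. f (Z n \<omega>))) \<longlonglongrightarrow> integral\<^sup>L Q f)"

text \<open>Q is the (possibly degenerate) centred multivariate normal law with symmetric
  covariance matrix V, defined through its characteristic function.\<close>
definition gaussian_vec :: "real ^ 'g ^ 'g \<Rightarrow> (real ^ 'g) measure \<Rightarrow> bool" where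
  "gaussian_vec V Q \<longleftrightarrow>
     prob_space Q \<and> sets Q = sets borel \<and> transpose V = V \<and>
     (\<forall>t. integral\<^sup>L Q (\<lambda>z. cis (t \<bullet> z)) = complex_of_real (exp (- (t \<bullet> (V *v t)) / 2)))"

definition is_avar :: "'a measure \<Rightarrow> (nat \<Rightarrow> 'a \<Rightarrow> real ^ 'g) \<Rightarrow> real ^ 'g ^ 'g \<Rightarrow> bool" where
  "is_avar M Z V \<longleftrightarrow> (\<exists>Q. gaussian_vec V Q \<and> conv_in_distr M Z Q)"

definition psd :: "real ^ 'n ^ 'n \<Rightarrow> bool" where
  "psd A \<longleftrightarrow> (\<forall>c. 0 \<le> c \<bullet> (A *v c))"

section \<open>Population quantities (computed from unit 0; units are i.i.d.)\<close>

definition mu :: "'a measure \<Rightarrow> (nat \<Rightarrow> 'a \<Rightarrow> real ^ 'g) \<Rightarrow> real ^ 'g" where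
  "mu M Y = (\<chi> g. integral\<^sup>L M (\<lambda>\<omega>. Y 0 \<omega> $ g))"

definition rho :: "'a measure \<Rightarrow> (nat \<Rightarrow> 'a \<Rightarrow> real ^ 'g) \<Rightarrow> 'g \<Rightarrow> real" where
  "rho M W g = measure M {\<omega> \<in> space M. W 0 \<omega> $ g = 1}"

definition meanX :: "'a measure \<Rightarrow> (nat \<Rightarrow> 'a \<Rightarrow> real ^ 'k) \<Rightarrow> real ^ 'k" where
  "meanX M X = (\<chi> k. integral\<^sup>L M (\<lambda>\<omega>. X 0 \<omega> $ k))"

definition Xdot :: "'a measure \<Rightarrow> (nat \<Rightarrow> 'a \<Rightarrow> real ^ 'k) \<Rightarrow> nat \<Rightarrow> 'a \<Rightarrow> real ^ 'k" where
  "Xdot M X i \<omega> = X i \<omega> - meanX M X"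

definition SigmaX :: "'a measure \<Rightarrow> (nat \<Rightarrow> 'a \<Rightarrow> real ^ 'k) \<Rightarrow> real ^ 'k ^ 'k" where
  "SigmaX M X = (\<chi> j l. integral\<^sup>L M (\<lambda>\<omega>. Xdot M X 0 \<omega> $ j * Xdot M X 0 \<omega> $ l))"

text \<open>Population linear projection coefficient of Y(g) - mu_g on Xdot:
  beta_g = E(Xdot' Xdot)^{-1} E(Xdot' (Y(g) - mu_g)).\<close>
definition beta ::
  "'a measure \<Rightarrow> (nat \<Rightarrow> 'a \<Rightarrow> real ^ 'g) \<Rightarrow> (nat \<Rightarrow> 'a \<Rightarrow> real ^ 'k) \<Rightarrow> 'g \<Rightarrow> real ^ 'k" where
  "beta M Y X g = matrix_inv (SigmaX M X) *v
     (\<chi> j. integral\<^sup>L M (\<lambda>\<omega>. Xdot M X 0 \<omega> $ j * (Y 0 \<omega> $ g - mu M Y $ g)))"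

definition Lvec ::
  "'a measure \<Rightarrow> (nat \<Rightarrow> 'a \<Rightarrow> real ^ 'g) \<Rightarrow> (nat \<Rightarrow> 'a \<Rightarrow> real ^ 'g) \<Rightarrow> (nat \<Rightarrow> 'a \<Rightarrow> real ^ 'k)
    \<Rightarrow> nat \<Rightarrow> 'a \<Rightarrow> real ^ 'g" where
  "Lvec M W Y X i \<omega> = (\<chi> g. W i \<omega> $ g * (Xdot M X i \<omega> \<bullet> beta M Y X g) / rho M W g)"

definition Kvec ::
  "'a measure \<Rightarrow> (nat \<Rightarrow> 'a \<Rightarrow> real ^ 'g) \<Rightarrow> (nat \<Rightarrow> 'a \<Rightarrow> real ^ 'k) \<Rightarrow> nat \<Rightarrow> 'a \<Rightarrow> real ^ 'g" where
  "Kvec M Y X i \<omega> = (\<chi> g. Xdot M X i \<omega> \<bullet> beta M Y X g)"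

definition OmegaL ::
  "'a measure \<Rightarrow> (nat \<Rightarrow> 'a \<Rightarrow> real ^ 'g) \<Rightarrow> (nat \<Rightarrow> 'a \<Rightarrow> real ^ 'g) \<Rightarrow> (nat \<Rightarrow> 'a \<Rightarrow> real ^ 'k)
     \<Rightarrow> real ^ 'g ^ 'g" where
  "OmegaL M W Y X = (\<chi> g h. integral\<^sup>L M (\<lambda>\<omega>. Lvec M W Y X 0 \<omega> $ g * Lvec M W Y X 0 \<omega> $ h))"

definition OmegaK ::
  "'a measure \<Rightarrow> (nat \<Rightarrow> 'a \<Rightarrow> real ^ 'g) \<Rightarrow> (nat \<Rightarrow> 'a \<Rightarrow> real ^ 'k) \<Rightarrow> real ^ 'g ^ 'g" where
  "OmegaK M Y X = (\<chi> g h. integral\<^sup>L M (\<lambda>\<omega>. Kvec M Y X 0 \<omega> $ g * Kvec M Y X 0 \<omega> $ h))"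

definition Yobs :: "(nat \<Rightarrow> 'a \<Rightarrow> real ^ 'g) \<Rightarrow> (nat \<Rightarrow> 'a \<Rightarrow> real ^ 'g) \<Rightarrow> nat \<Rightarrow> 'a \<Rightarrow> real" where
  "Yobs W Y i \<omega> = (\<Sum>g\<in>UNIV. W i \<omega> $ g * Y i \<omega> $ g)"

definition Ng :: "(nat \<Rightarrow> 'a \<Rightarrow> real ^ 'g) \<Rightarrow> nat \<Rightarrow> 'g \<Rightarrow> 'a \<Rightarrow> real" where
  "Ng W N g \<omega> = (\<Sum>i<N. W i \<omega> $ g)"

definition Ybar :: "(nat \<Rightarrow> 'a \<Rightarrow> real ^ 'g) \<Rightarrow> (nat \<Rightarrow> 'a \<Rightarrow> real ^ 'g) \<Rightarrow> nat \<Rightarrow> 'g \<Rightarrow> 'a \<Rightarrow> real" where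
  "Ybar W Y N g \<omega> = (\<Sum>i<N. W i \<omega> $ g * Yobs W Y i \<omega>) / Ng W N g \<omega>"

definition Xbar_g :: "(nat \<Rightarrow> 'a \<Rightarrow> real ^ 'g) \<Rightarrow> (nat \<Rightarrow> 'a \<Rightarrow> real ^ 'k) \<Rightarrow> nat \<Rightarrow> 'g \<Rightarrow> 'a \<Rightarrow> real ^ 'k" where
  "Xbar_g W X N g \<omega> = (1 / Ng W N g \<omega>) *\<^sub>R (\<Sum>i<N. W i \<omega> $ g *\<^sub>R X i \<omega>)"

definition Xbar :: "(nat \<Rightarrow> 'a \<Rightarrow> real ^ 'k) \<Rightarrow> nat \<Rightarrow> 'a \<Rightarrow> real ^ 'k" where
  "Xbar X N \<omega> = (1 / real N) *\<^sub>R (\<Sum>i<N. X i \<omega>)"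

text \<open>OLS slopes from regressing Y_i on 1, X_i among units with W_ig = 1
  (closed form: within-group centred cross-product matrices).\<close>
definition beta_hat ::
  "(nat \<Rightarrow> 'a \<Rightarrow> real ^ 'g) \<Rightarrow> (nat \<Rightarrow> 'a \<Rightarrow> real ^ 'g) \<Rightarrow> (nat \<Rightarrow> 'a \<Rightarrow> real ^ 'k)
     \<Rightarrow> nat \<Rightarrow> 'g \<Rightarrow> 'a \<Rightarrow> real ^ 'k" where
  "beta_hat W Y X N g \<omega> =
     matrix_inv (\<chi> j l. \<Sum>i<N. W i \<omega> $ g * (X i \<omega> - Xbar_g W X N g \<omega>) $ j
                                         * (X i \<omega> - Xbar_g W X N g \<omega>) $ l)
     *v (\<chi> j. \<Sum>i<N. W i \<omega> $ g * (X i \<omega> - Xbar_g W X N g \<omega>) $ j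
                                 * (Yobs W Y i \<omega> - Ybar W Y N g \<omega>))"

definition alpha_hat ::
  "(nat \<Rightarrow> 'a \<Rightarrow> real ^ 'g) \<Rightarrow> (nat \<Rightarrow> 'a \<Rightarrow> real ^ 'g) \<Rightarrow> (nat \<Rightarrow> 'a \<Rightarrow> real ^ 'k)
     \<Rightarrow> nat \<Rightarrow> 'g \<Rightarrow> 'a \<Rightarrow> real" where
  "alpha_hat W Y X N g \<omega> = Ybar W Y N g \<omega> - Xbar_g W X N g \<omega> \<bullet> beta_hat W Y X N g \<omega>"

definition mu_SM :: "(nat \<Rightarrow> 'a \<Rightarrow> real ^ 'g) \<Rightarrow> (nat \<Rightarrow> 'a \<Rightarrow> real ^ 'g) \<Rightarrow> nat \<Rightarrow> 'a \<Rightarrow> real ^ 'g" where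
  "mu_SM W Y N \<omega> = (\<chi> g. Ybar W Y N g \<omega>)"

definition mu_SRA ::
  "(nat \<Rightarrow> 'a \<Rightarrow> real ^ 'g) \<Rightarrow> (nat \<Rightarrow> 'a \<Rightarrow> real ^ 'g) \<Rightarrow> (nat \<Rightarrow> 'a \<Rightarrow> real ^ 'k)
     \<Rightarrow> nat \<Rightarrow> 'a \<Rightarrow> real ^ 'g" where
  "mu_SRA W Y X N \<omega> = (\<chi> g. alpha_hat W Y X N g \<omega> + Xbar X N \<omega> \<bullet> beta_hat W Y X N g \<omega>)"

end

theory Submission
  imports Defs
begin

text \<open>
  Both estimators are asymptotically linear: up to a remainder that is \<open>o(1)\<close> in probability,
  \<open>sqrt N *\<^sub>R (estimate - \<mu>)\<close> is \<open>(\<Sum>i<N. \<xi>\<^sub>i) / sqrt N\<close>. With \<open>K\<^sub>g = Xdot \<bullet> \<beta>\<^sub>g\<close> and the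
  projection residual \<open>U\<^sub>g = Y(g) - \<mu>\<^sub>g - K\<^sub>g\<close>, the summands are \<open>W\<^sub>g (U\<^sub>g + K\<^sub>g) / \<rho>\<^sub>g\<close> for the
  subsample means and \<open>W\<^sub>g U\<^sub>g / \<rho>\<^sub>g + K\<^sub>g\<close> for regression adjustment. Since \<open>W\<close> is independent of
  \<open>(Y, X)\<close>, \<open>W\<^sub>g W\<^sub>h = 0\<close> for \<open>g \<noteq> h\<close>, and \<open>U\<^sub>g\<close> is uncorrelated with every \<open>K\<^sub>h\<close>, the difference
  of the two covariance matrices is \<open>E[K\<^sub>g K\<^sub>h] (\<delta>\<^sub>g\<^sub>h / \<rho>\<^sub>g - 1)\<close>, that is \<open>\<Omega>\<^sub>L - \<Omega>\<^sub>K\<close>.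

  Multivariate convergence in distribution is obtained from one-dimensional characteristic
  functions: a tight sequence whose characteristic functions converge can be tested against
  trigonometric polynomials, which approximate bounded continuous functions on cubes without
  losing the global bound.
\<close>

section \<open>Convergence in probability\<close>

text \<open>With high probability: the filter is chosen so that \<open>f \<longlongrightarrow> c\<close> along it is
  convergence of \<open>f\<close> to \<open>c\<close> in probability, and the usual limit calculus applies. It lives on
  pairs (sample size, outcome) and needs no measurability of \<open>f\<close>.\<close>

definition whp :: "'a measure \<Rightarrow> (nat \<times> 'a) filter" where
  "whp M = Abs_filter (\<lambda>P. \<forall>\<delta>>0. \<forall>\<^sub>F n in sequentially.
     \<exists>A\<in>sets M. measure M A < \<delta> \<and> (\<forall>\<omega>\<in>space M - A. P (n, \<omega>)))"

lemma eventually_whp: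
  "eventually P (whp M) \<longleftrightarrow> (\<forall>\<delta>>0. \<forall>\<^sub>F n in sequentially.
     \<exists>A\<in>sets M. measure M A < \<delta> \<and> (\<forall>\<omega>\<in>space M - A. P (n, \<omega>)))"
  unfolding whp_def
proof (rule eventually_Abs_filter, rule is_filter.intro)
  show "\<forall>\<delta>>0. \<forall>\<^sub>F n in sequentially.
     \<exists>A\<in>sets M. measure M A < \<delta> \<and> (\<forall>\<omega>\<in>space M - A. True)"
    by (auto intro!: always_eventually bexI[of _ "{}"])
next
  fix P Q :: "nat \<times> 'a \<Rightarrow> bool"
  assume P: "\<forall>\<delta>>0. \<forall>\<^sub>F n in sequentially. \<exists>A\<in>sets M. measure M A < \<delta> \<and> (\<forall>\<omega>\<in>space M - A. P (n, \<omega>))"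
    and Q: "\<forall>\<delta>>0. \<forall>\<^sub>F n in sequentially. \<exists>A\<in>sets M. measure M A < \<delta> \<and> (\<forall>\<omega>\<in>space M - A. Q (n, \<omega>))"
  show "\<forall>\<delta>>0. \<forall>\<^sub>F n in sequentially.
     \<exists>A\<in>sets M. measure M A < \<delta> \<and> (\<forall>\<omega>\<in>space M - A. P (n, \<omega>) \<and> Q (n, \<omega>))"
  proof (intro allI impI)
    fix \<delta> :: real assume "\<delta> > 0"
    then have "\<delta> / 2 > 0" by simp
    from P[rule_format, OF this] Q[rule_format, OF this]
    show "\<forall>\<^sub>F n in sequentially.
     \<exists>A\<in>sets M. measure M A < \<delta> \<and> (\<forall>\<omega>\<in>space M - A. P (n, \<omega>) \<and> Q (n, \<omega>))"
    proof eventually_elim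
      case (elim n)
      then obtain A B where "A \<in> sets M" "measure M A < \<delta> / 2" "\<forall>\<omega>\<in>space M - A. P (n, \<omega>)"
        "B \<in> sets M" "measure M B < \<delta> / 2" "\<forall>\<omega>\<in>space M - B. Q (n, \<omega>)"
        by blast
      moreover from this have "measure M (A \<union> B) < \<delta>"
        using measure_Un_le[of A M B] by simp
      ultimately show ?case
        by (intro bexI[of _ "A \<union> B"]) auto
    qed
  qed
next
  fix P Q :: "nat \<times> 'a \<Rightarrow> bool"
  assume "\<forall>x. P x \<longrightarrow> Q x"
    and P: "\<forall>\<delta>>0. \<forall>\<^sub>F n in sequentially. \<exists>A\<in>sets M. measure M A < \<delta> \<and> (\<forall>\<omega>\<in>space M - A. P (n, \<omega>))"
  then show "\<forall>\<delta>>0. \<forall>\<^sub>F n in sequentially. \<exists>A\<in>sets M. measure M A < \<delta> \<and> (\<forall>\<omega>\<in>space M - A. Q (n, \<omega>))"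
    by (fast elim: eventually_mono)
qed

lemma eventually_whp_surely:
  assumes "\<forall>\<^sub>F n in sequentially. \<forall>\<omega>\<in>space M. P (n, \<omega>)"
  shows "eventually P (whp M)"
  unfolding eventually_whp using assms
  by (auto elim!: eventually_mono intro!: bexI[of _ "{}"])

definition bounded_in_prob ::
  "'a measure \<Rightarrow> (nat \<Rightarrow> 'a \<Rightarrow> 'b::real_normed_vector) \<Rightarrow> bool" where
  "bounded_in_prob M S \<longleftrightarrow> (\<forall>\<delta>>0. \<exists>L. \<forall>\<^sub>F n in sequentially.
     \<exists>A\<in>sets M. measure M A < \<delta> \<and> (\<forall>\<omega>\<in>space M - A. norm (S n \<omega>) \<le> L))"

lemma bounded_in_prob_add_null:
  assumes S: "bounded_in_prob M S"
    and R: "((\<lambda>(n, \<omega>). Z n \<omega> - S n \<omega>) \<longlongrightarrow> 0) (whp M)"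
  shows "bounded_in_prob M Z"
  unfolding bounded_in_prob_def
proof (intro allI impI)
  fix \<delta> :: real assume "\<delta> > 0"
  then have d: "\<delta> / 2 > 0" by simp
  from S d obtain L where L: "\<forall>\<^sub>F n in sequentially.
     \<exists>A\<in>sets M. measure M A < \<delta> / 2 \<and> (\<forall>\<omega>\<in>space M - A. norm (S n \<omega>) \<le> L)"
    unfolding bounded_in_prob_def by blast
  have "eventually (\<lambda>(n, \<omega>). norm (Z n \<omega> - S n \<omega>) < 1) (whp M)"
    using tendstoD[OF R, of 1] by (simp add: case_prod_unfold)
  then have "\<forall>\<^sub>F n in sequentially. \<exists>A\<in>sets M. measure M A < \<delta> / 2 \<and>
      (\<forall>\<omega>\<in>space M - A. norm (Z n \<omega> - S n \<omega>) < 1)"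
    unfolding eventually_whp prod.case using d by blast
  with L have "\<forall>\<^sub>F n in sequentially.
     \<exists>A\<in>sets M. measure M A < \<delta> \<and> (\<forall>\<omega>\<in>space M - A. norm (Z n \<omega>) \<le> L + 1)"
  proof eventually_elim
    case (elim n)
    then obtain A B where *: "A \<in> sets M" "measure M A < \<delta> / 2" "\<forall>\<omega>\<in>space M - A. norm (S n \<omega>) \<le> L"
      "B \<in> sets M" "measure M B < \<delta> / 2" "\<forall>\<omega>\<in>space M - B. norm (Z n \<omega> - S n \<omega>) < 1"
      by blast
    have "norm (Z n \<omega>) \<le> L + 1" if "\<omega> \<in> space M - (A \<union> B)" for \<omega>
    proof -
      have "norm (S n \<omega>) \<le> L" "norm (Z n \<omega> - S n \<omega>) < 1" using * that by auto
      then show ?thesis using norm_triangle_sub[of "Z n \<omega>" "S n \<omega>"] by linarith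
    qed
    moreover have "measure M (A \<union> B) < \<delta>"
      using measure_Un_le[of A M B] * by simp
    ultimately show ?case
      using * by (intro bexI[of _ "A \<union> B"]) auto
  qed
  then show "\<exists>L. \<forall>\<^sub>F n in sequentially.
     \<exists>A\<in>sets M. measure M A < \<delta> \<and> (\<forall>\<omega>\<in>space M - A. norm (Z n \<omega>) \<le> L)" by blast
qed

lemma tendsto_null_mult_bounded_in_prob:
  fixes S :: "nat \<Rightarrow> 'a \<Rightarrow> real"
  assumes r: "((\<lambda>(n, \<omega>). r n \<omega>) \<longlongrightarrow> 0) (whp M)" and S: "bounded_in_prob M S"
  shows "((\<lambda>(n, \<omega>). r n \<omega> * S n \<omega>) \<longlongrightarrow> 0) (whp M)"
proof (rule tendstoI)
  fix e :: real assume e: "e > 0"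
  show "eventually (\<lambda>x. dist (case x of (n, \<omega>) \<Rightarrow> r n \<omega> * S n \<omega>) 0 < e) (whp M)"
    unfolding eventually_whp
  proof (intro allI impI)
    fix \<delta> :: real assume "\<delta> > 0"
    then have d: "\<delta> / 2 > 0" by simp
    from S d obtain L0 where L0: "\<forall>\<^sub>F n in sequentially.
       \<exists>A\<in>sets M. measure M A < \<delta> / 2 \<and> (\<forall>\<omega>\<in>space M - A. norm (S n \<omega>) \<le> L0)"
      unfolding bounded_in_prob_def by blast
    define L where "L = max L0 1"
    have L: "L > 0" "L0 \<le> L" by (auto simp: L_def)
    have "eventually (\<lambda>(n, \<omega>). norm (r n \<omega>) < e / L) (whp M)"
      using tendstoD[OF r, of "e / L"] e L by (simp add: case_prod_unfold)
    then have "\<forall>\<^sub>F n in sequentially. \<exists>A\<in>sets M. measure M A < \<delta> / 2 \<and>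
        (\<forall>\<omega>\<in>space M - A. norm (r n \<omega>) < e / L)"
      unfolding eventually_whp prod.case using d by blast
    with L0 show "\<forall>\<^sub>F n in sequentially. \<exists>A\<in>sets M. measure M A < \<delta> \<and>
        (\<forall>\<omega>\<in>space M - A. dist (case (n, \<omega>) of (n, \<omega>) \<Rightarrow> r n \<omega> * S n \<omega>) 0 < e)"
    proof eventually_elim
      case (elim n)
      then obtain A B where *: "A \<in> sets M" "measure M A < \<delta> / 2" "\<forall>\<omega>\<in>space M - A. norm (S n \<omega>) \<le> L0"
        "B \<in> sets M" "measure M B < \<delta> / 2" "\<forall>\<omega>\<in>space M - B. norm (r n \<omega>) < e / L"
        by blast
      have "\<bar>r n \<omega> * S n \<omega>\<bar> < e" if "\<omega> \<in> space M - (A \<union> B)" for \<omega>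
      proof -
        have "\<bar>S n \<omega>\<bar> \<le> L" "\<bar>r n \<omega>\<bar> < e / L" using * that L by (auto intro: order_trans[OF _ L(2)])
        then have "\<bar>r n \<omega>\<bar> * \<bar>S n \<omega>\<bar> \<le> \<bar>r n \<omega>\<bar> * L" by (intro mult_left_mono) auto
        also have "\<dots> < e" using \<open>\<bar>r n \<omega>\<bar> < e / L\<close> L by (simp add: field_simps)
        finally show ?thesis by (simp add: abs_mult)
      qed
      moreover have "measure M (A \<union> B) < \<delta>"
        using measure_Un_le[of A M B] * by simp
      ultimately show ?case
        using * by (intro bexI[of _ "A \<union> B"]) auto
    qed
  qed
qed

lemma (in prob_space) norm_integral_diff_le:
  fixes f g :: "'a \<Rightarrow> 'b::{banach, second_countable_topology}"
  assumes [measurable]: "f \<in> borel_measurable M" "g \<in> borel_measurable M" "A \<in> sets M"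
    and f: "\<And>x. x \<in> space M \<Longrightarrow> norm (f x) \<le> B"
    and g: "\<And>x. x \<in> space M \<Longrightarrow> norm (g x) \<le> C"
    and e: "0 \<le> e" "\<And>x. x \<in> space M - A \<Longrightarrow> norm (f x - g x) \<le> e"
  shows "norm (expectation f - expectation g) \<le> e + (B + C) * prob A"
proof -
  have i: "integrable M f" "integrable M g"
    using f g by (auto intro!: integrable_const_bound AE_I2)
  have i': "integrable M (\<lambda>x. (B + C) * indicator A x)"
    by (intro integrable_mult_right integrable_real_indicator) (auto simp: emeasure_eq_measure)
  have "norm (expectation f - expectation g) = norm (expectation (\<lambda>x. f x - g x))"
    using i by simp
  also have "\<dots> \<le> expectation (\<lambda>x. norm (f x - g x))"
    by (rule integral_norm_bound)
  also have "\<dots> \<le> expectation (\<lambda>x. e + (B + C) * indicator A x)"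
  proof (rule integral_mono)
    fix x assume x: "x \<in> space M"
    have "norm (f x - g x) \<le> B + C"
      using norm_triangle_ineq4[of "f x" "g x"] f[OF x] g[OF x] by linarith
    then show "norm (f x - g x) \<le> e + (B + C) * indicator A x"
      using e x by (auto simp: indicator_def intro: order_trans)
  qed (use i i' in auto)
  also have "\<dots> = e + (B + C) * prob A"
    using i' by (simp add: prob_space)
  finally show ?thesis .
qed

lemma borel_measurable_cis [measurable]: "cis \<in> borel_measurable borel"
  by (intro borel_measurable_continuous_onI continuous_intros)

section \<open>Weak convergence from characteristic functions\<close>

inductive trig_poly :: "('a::real_inner \<Rightarrow> real) \<Rightarrow> bool" where
  cos: "trig_poly (\<lambda>x. c * cos (t \<bullet> x + s))"
| add: "trig_poly f \<Longrightarrow> trig_poly g \<Longrightarrow> trig_poly (\<lambda>x. f x + g x)"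

lemma trig_poly_const: "trig_poly (\<lambda>x. c)"
  using trig_poly.cos[of c 0 0] by simp

lemma trig_poly_sum: "(\<And>i. i \<in> I \<Longrightarrow> trig_poly (f i)) \<Longrightarrow> trig_poly (\<lambda>x. \<Sum>i\<in>I. f i x)"
  by (induction I rule: infinite_finite_induct) (auto intro: trig_poly_const trig_poly.add)

lemma trig_poly_mult:
  assumes "trig_poly f" "trig_poly g"
  shows "trig_poly (\<lambda>x. f x * g x)"
  using assms(1)
proof induction
  case (cos c t s)
  show ?case using assms(2)
  proof induction
    case (cos c' t' s')
    have "(\<lambda>x. c * cos (t \<bullet> x + s) * (c' * cos (t' \<bullet> x + s'))) =
      (\<lambda>x. (c * c' / 2) * cos ((t - t') \<bullet> x + (s - s')) + (c * c' / 2) * cos ((t + t') \<bullet> x + (s + s')))"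
    proof
      fix x
      have 1: "(t - t') \<bullet> x + (s - s') = (t \<bullet> x + s) - (t' \<bullet> x + s')"
        and 2: "(t + t') \<bullet> x + (s + s') = (t \<bullet> x + s) + (t' \<bullet> x + s')"
        by (simp_all add: algebra_simps)
      show "c * cos (t \<bullet> x + s) * (c' * cos (t' \<bullet> x + s')) =
        (c * c' / 2) * cos ((t - t') \<bullet> x + (s - s')) + (c * c' / 2) * cos ((t + t') \<bullet> x + (s + s'))"
        unfolding 1 2 cos_diff cos_add[of "t \<bullet> x + s"] by (simp add: field_simps)
    qed
    then show ?case by (simp only:) (intro trig_poly.intros)
  next
    case (add f g)
    then show ?case by (simp add: distrib_left trig_poly.add)
  qed
next
  case (add f g)
  then show ?case by (simp add: distrib_right trig_poly.add)
qed

lemma trig_poly_compose_sin: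
  fixes p :: "real ^ 'n \<Rightarrow> real"
  assumes "real_polynomial_function p"
  shows "trig_poly (\<lambda>x. p (\<chi> j. sin (c * x $ j)))"
  using assms
proof induction
  case (linear f)
  interpret bounded_linear f by fact
  have "f (\<chi> j. sin (c * x $ j)) = (\<Sum>j\<in>UNIV. f (axis j 1) * cos ((c *\<^sub>R axis j 1) \<bullet> x + (- pi / 2)))" for x
  proof -
    have "(\<chi> j. sin (c * x $ j)) = (\<Sum>j\<in>UNIV. sin (c * x $ j) *\<^sub>R (axis j 1 :: real ^ 'n))"
      by (simp add: vec_eq_iff axis_def if_distrib cong: if_cong)
    moreover have "cos ((c *\<^sub>R axis j 1) \<bullet> x + (- pi / 2)) = sin (c * x $ j)" for j
      by (simp add: inner_axis' sin_cos_eq) (metis cos_minus minus_diff_eq)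
    ultimately show ?thesis by (simp add: sum scaleR mult.commute)
  qed
  then show ?case by (simp only:) (intro trig_poly_sum trig_poly.cos)
qed (auto intro: trig_poly_const trig_poly.add trig_poly_mult)

lemma trig_poly_continuous: "trig_poly f \<Longrightarrow> continuous_on UNIV f"
  by (induction rule: trig_poly.induct) (auto intro!: continuous_intros)

lemma trig_poly_bounded: "trig_poly f \<Longrightarrow> \<exists>B. \<forall>x. \<bar>f x\<bar> \<le> B"
proof (induction rule: trig_poly.induct)
  case (cos c t s)
  have "\<bar>c * cos (t \<bullet> x + s)\<bar> \<le> \<bar>c\<bar>" for x
    using abs_cos_le_one[of "t \<bullet> x + s"] by (simp add: abs_mult mult_left_le)
  then show ?case by blast
next
  case (add f g)
  then obtain B C where "\<And>x. \<bar>f x\<bar> \<le> B" "\<And>x. \<bar>g x\<bar> \<le> C" by blast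
  then have "\<bar>f x + g x\<bar> \<le> B + C" for x
    by (meson abs_triangle_ineq add_mono order_trans)
  then show ?case by blast
qed

text \<open>Composing with the clamp \<open>x \<mapsto> arcsin (sin x)\<close>, which is the identity near 0, makes the
  approximation uniform on a cube while keeping the global bound.\<close>

lemma trig_poly_approx:
  fixes f :: "real ^ 'n \<Rightarrow> real"
  assumes f: "continuous_on UNIV f" "\<And>x. \<bar>f x\<bar> \<le> B" and "L > 0" "e > 0"
  obtains T where "trig_poly T" "\<And>x. \<bar>T x\<bar> \<le> B + e" "\<And>x. norm x \<le> L \<Longrightarrow> \<bar>f x - T x\<bar> \<le> e"
proof -
  define c where "c = pi / (2 * L)"
  have c: "c > 0" using \<open>L > 0\<close> by (simp add: c_def)
  let ?S = "cbox (-1) (1 :: real ^ 'n)"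
  define h where "h s = f (\<chi> j. arcsin (s $ j) / c)" for s :: "real ^ 'n"
  have "continuous_on ?S h"
    unfolding h_def
    by (rule continuous_on_compose2[OF f(1)])
      (use c in \<open>auto intro!: continuous_intros simp: mem_box_cart\<close>)
  then obtain p where p: "real_polynomial_function p" "\<And>s. s \<in> ?S \<Longrightarrow> \<bar>h s - p s\<bar> < e"
    using Stone_Weierstrass_real_polynomial_function[OF compact_cbox _ \<open>e > 0\<close>] by blast
  define T where "T x = p (\<chi> j. sin (c * x $ j))" for x
  have S: "(\<chi> j. sin (c * x $ j)) \<in> ?S" for x :: "real ^ 'n"
    by (auto simp: mem_box_cart)
  show thesis
  proof
    show "trig_poly T" unfolding T_def by (rule trig_poly_compose_sin[OF p(1)])
    show "\<bar>T x\<bar> \<le> B + e" for x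
      using p(2)[OF S[of x]] f(2)[of "\<chi> j. arcsin ((\<chi> j. sin (c * x $ j)) $ j) / c"]
      unfolding T_def h_def by linarith
    show "\<bar>f x - T x\<bar> \<le> e" if "norm x \<le> L" for x
    proof -
      have "arcsin (sin (c * x $ j)) = c * x $ j" for j
      proof (rule arcsin_sin)
        have "\<bar>x $ j\<bar> \<le> L" using that component_le_norm_cart[of x j] by linarith
        then have "\<bar>c * x $ j\<bar> \<le> c * L" using c by (simp add: abs_mult)
        also have "c * L = pi / 2" using \<open>L > 0\<close> by (simp add: c_def)
        finally show "- (pi / 2) \<le> c * x $ j" "c * x $ j \<le> pi / 2" by auto
      qed
      then have "h (\<chi> j. sin (c * x $ j)) = f x" using c by (simp add: h_def)
      then show ?thesis using p(2)[OF S[of x]] by (simp add: T_def)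
    qed
  qed
qed

lemma trig_poly_integral_tendsto:
  fixes Z :: "nat \<Rightarrow> 'a \<Rightarrow> 'b::euclidean_space"
  assumes "prob_space M" "prob_space Q" and [simp]: "sets Q = sets borel"
    and [measurable]: "\<And>n. Z n \<in> borel_measurable M"
    and lim: "\<And>t. (\<lambda>n. \<integral>\<omega>. cis (t \<bullet> Z n \<omega>) \<partial>M) \<longlonglongrightarrow> (\<integral>z. cis (t \<bullet> z) \<partial>Q)"
    and "trig_poly T"
  shows "(\<lambda>n. \<integral>\<omega>. T (Z n \<omega>) \<partial>M) \<longlonglongrightarrow> (\<integral>z. T z \<partial>Q)"
  using \<open>trig_poly T\<close>
proof induction
  interpret M: prob_space M by fact
  interpret Q: prob_space Q by fact
  note [measurable_cong] = \<open>sets Q = sets borel\<close>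
  {
    case (cos c t s)
    have *: "cos (t \<bullet> z + s) = Re (cis s * cis (t \<bullet> z))" for z
      by (simp add: cis_mult add.commute)
    have "(\<integral>\<omega>. c * cos (t \<bullet> Z n \<omega> + s) \<partial>M) = c * Re (cis s * (\<integral>\<omega>. cis (t \<bullet> Z n \<omega>) \<partial>M))" for n
    proof -
      have "integrable M (\<lambda>\<omega>. cis (t \<bullet> Z n \<omega>))"
        by (rule M.integrable_const_bound[where B=1]) auto
      then show ?thesis unfolding * by (subst integral_mult_right_zero, subst integral_Re) auto
    qed
    moreover have "(\<integral>z. c * cos (t \<bullet> z + s) \<partial>Q) = c * Re (cis s * (\<integral>z. cis (t \<bullet> z) \<partial>Q))"
    proof -
      have "integrable Q (\<lambda>z. cis (t \<bullet> z))"
        by (rule Q.integrable_const_bound[where B=1]) auto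
      then show ?thesis unfolding * by (subst integral_mult_right_zero, subst integral_Re) auto
    qed
    ultimately show ?case by (simp only:) (intro tendsto_intros lim)
  next
    case (add f g)
    obtain B C where BC: "\<And>x. \<bar>f x\<bar> \<le> B" "\<And>x. \<bar>g x\<bar> \<le> C"
      using add.hyps[THEN trig_poly_bounded] by auto
    have [measurable]: "f \<in> borel_measurable borel" "g \<in> borel_measurable borel"
      using add.hyps by (auto intro!: borel_measurable_continuous_onI trig_poly_continuous)
    have "integrable M (\<lambda>\<omega>. f (Z n \<omega>))" "integrable M (\<lambda>\<omega>. g (Z n \<omega>))" for n
      using BC by (auto intro!: M.integrable_const_bound AE_I2)
    moreover have "integrable Q f" "integrable Q g"
      using BC by (auto intro!: Q.integrable_const_bound AE_I2)
    ultimately show ?case using tendsto_add[OF add.IH] by simp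
  }
qed

lemma (in prob_space) ex_norm_tail_less:
  fixes Z :: "'a \<Rightarrow> 'b::euclidean_space"
  assumes [measurable]: "Z \<in> borel_measurable M" and "d > 0"
  shows "\<exists>L. \<forall>L'\<ge>L. prob {\<omega>\<in>space M. norm (Z \<omega>) > L'} < d"
proof -
  let ?A = "\<lambda>n::nat. {\<omega>\<in>space M. norm (Z \<omega>) > real n}"
  have "(\<lambda>n. prob (?A n)) \<longlonglongrightarrow> prob (\<Inter>n. ?A n)"
    by (rule finite_Lim_measure_decseq) (auto simp: decseq_def intro: le_less_trans)
  also have "(\<Inter>n. ?A n) = {}"
  proof -
    have "\<exists>n. \<not> real n < norm (Z \<omega>)" for \<omega>
      using reals_Archimedean2[of "norm (Z \<omega>)"] by (auto simp: not_less intro: less_imp_le)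
    then show ?thesis by blast
  qed
  finally have "(\<lambda>n. prob (?A n)) \<longlonglongrightarrow> 0" by simp
  from order_tendstoD(2)[OF this \<open>d > 0\<close>] obtain n where n: "prob (?A n) < d"
    by (auto simp: eventually_sequentially)
  have "prob {\<omega>\<in>space M. norm (Z \<omega>) > L'} < d" if "L' \<ge> real n" for L'
    by (rule le_less_trans[OF _ n], rule finite_measure_mono) (use that in auto)
  then show ?thesis by blast
qed

theorem conv_in_distr_char:
  fixes Z :: "nat \<Rightarrow> 'a \<Rightarrow> real ^ 'n"
  assumes "prob_space M" "prob_space Q" and sets_Q: "sets Q = sets borel"
    and [measurable]: "\<And>n. Z n \<in> borel_measurable M"
    and tight: "bounded_in_prob M Z"
    and lim: "\<And>t. (\<lambda>n. \<integral>\<omega>. cis (t \<bullet> Z n \<omega>) \<partial>M) \<longlonglongrightarrow> (\<integral>z. cis (t \<bullet> z) \<partial>Q)"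
  shows "conv_in_distr M Z Q"
  unfolding conv_in_distr_def
proof (intro conjI allI impI)
  interpret M: prob_space M by fact
  interpret Q: prob_space Q by fact
  note [measurable_cong] = sets_Q
  fix f :: "real ^ 'n \<Rightarrow> real" assume f: "continuous_on UNIV f \<and> bounded (range f)"
  then obtain B0 where B0: "\<And>x. \<bar>f x\<bar> \<le> B0" by (auto simp: bounded_iff)
  define B where "B = max B0 1"
  have B: "B > 0" "\<And>x. \<bar>f x\<bar> \<le> B" using B0 by (auto simp: B_def intro: le_max_iff_disj[THEN iffD2])
  have fm [measurable]: "f \<in> borel_measurable borel"
    using f by (intro borel_measurable_continuous_onI) auto
  show "(\<lambda>n. integral\<^sup>L M (\<lambda>\<omega>. f (Z n \<omega>))) \<longlonglongrightarrow> integral\<^sup>L Q f"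
  proof (rule tendstoI)
    fix e' :: real assume "e' > 0"
    define e where "e = min 1 (e' / 6)"
    have e: "e > 0" "e \<le> 1" "6 * e \<le> e'" using \<open>e' > 0\<close> by (auto simp: e_def)
    define d where "d = e / (2 * B + e)"
    have d: "d > 0" "(2 * B + e) * d = e" using e B by (auto simp: d_def)
    from tight d obtain L1 where L1: "\<forall>\<^sub>F n in sequentially.
       \<exists>A\<in>sets M. measure M A < d \<and> (\<forall>\<omega>\<in>space M - A. norm (Z n \<omega>) \<le> L1)"
      unfolding bounded_in_prob_def by blast
    obtain L2 where L2: "\<And>L'. L' \<ge> L2 \<Longrightarrow> Q.prob {z\<in>space Q. norm z > L'} < d"
      using Q.ex_norm_tail_less[of "\<lambda>z. z" d] d by auto
    define L where "L = max 1 (max L1 L2)"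
    have L: "L > 0" "L1 \<le> L" "L2 \<le> L" by (auto simp: L_def)
    obtain T where T: "trig_poly T" "\<And>x. \<bar>T x\<bar> \<le> B + e" "\<And>x. norm x \<le> L \<Longrightarrow> \<bar>f x - T x\<bar> \<le> e"
      using trig_poly_approx[of f B L e] f B L e by blast
    have [measurable]: "T \<in> borel_measurable borel"
      using T(1) by (intro borel_measurable_continuous_onI trig_poly_continuous)
    let ?A = "{z\<in>space Q. norm z > L}"
    have "norm (Q.expectation f - Q.expectation T) \<le> e + (B + (B + e)) * Q.prob ?A"
      by (rule Q.norm_integral_diff_le) (use B T e in auto)
    also have "\<dots> \<le> e + (2 * B + e) * d"
      using L2[OF L(3)] B e by (auto intro!: mult_left_mono)
    finally have QT: "\<bar>Q.expectation f - Q.expectation T\<bar> \<le> 2 * e" using d by simp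
    have MT: "\<bar>M.expectation (\<lambda>\<omega>. f (Z n \<omega>)) - M.expectation (\<lambda>\<omega>. T (Z n \<omega>))\<bar> \<le> 2 * e"
      if A: "A \<in> sets M" "measure M A < d" "\<forall>\<omega>\<in>space M - A. norm (Z n \<omega>) \<le> L1" for A n
    proof -
      have "norm (M.expectation (\<lambda>\<omega>. f (Z n \<omega>)) - M.expectation (\<lambda>\<omega>. T (Z n \<omega>)))
          \<le> e + (B + (B + e)) * M.prob A"
        proof (rule M.norm_integral_diff_le)
        fix x assume "x \<in> space M - A"
        then have "norm (Z n x) \<le> L" using A(3) L(2) by (auto intro: order_trans)
        then show "norm (f (Z n x) - T (Z n x)) \<le> e" using T(3) by simp
      qed (use B T e A in auto)
      also have "\<dots> \<le> e + (2 * B + e) * d"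
        using A B e by (auto intro!: mult_left_mono)
      finally show ?thesis using d by simp
    qed
    have "(\<lambda>n. M.expectation (\<lambda>\<omega>. T (Z n \<omega>))) \<longlonglongrightarrow> Q.expectation T"
      by (rule trig_poly_integral_tendsto[OF assms(1-3) _ lim T(1)]) simp
    from tendstoD[OF this e(1)] L1
    show "\<forall>\<^sub>F n in sequentially. dist (M.expectation (\<lambda>\<omega>. f (Z n \<omega>))) (Q.expectation f) < e'"
    proof eventually_elim
      case (elim n)
      then have "\<bar>M.expectation (\<lambda>\<omega>. f (Z n \<omega>)) - M.expectation (\<lambda>\<omega>. T (Z n \<omega>))\<bar> \<le> 2 * e"
        using MT by blast
      with QT elim(1) e show ?case by (simp add: dist_real_def)
    qed
  qed
qed simp

lemma conv_in_distr_asymptotically_equivalent: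
  fixes Z S :: "nat \<Rightarrow> 'a \<Rightarrow> real ^ 'n"
  assumes M: "prob_space M" and Q: "prob_space Q" and sets_Q: "sets Q = sets borel"
    and Zm: "\<And>n. Z n \<in> borel_measurable M" and Sm: "\<And>n. S n \<in> borel_measurable M"
    and tight: "bounded_in_prob M S"
    and lim: "\<And>t. (\<lambda>n. \<integral>\<omega>. cis (t \<bullet> S n \<omega>) \<partial>M) \<longlonglongrightarrow> (\<integral>z. cis (t \<bullet> z) \<partial>Q)"
    and null: "((\<lambda>(n, \<omega>). Z n \<omega> - S n \<omega>) \<longlongrightarrow> 0) (whp M)"
  shows "conv_in_distr M Z Q"
proof (rule conv_in_distr_char[OF M Q sets_Q Zm])
  show "bounded_in_prob M Z" by (rule bounded_in_prob_add_null[OF tight null])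
  fix t :: "real ^ 'n"
  interpret prob_space M by fact
  note [measurable] = Zm Sm
  have "(\<lambda>n. expectation (\<lambda>\<omega>. cis (t \<bullet> Z n \<omega>)) - expectation (\<lambda>\<omega>. cis (t \<bullet> S n \<omega>))) \<longlonglongrightarrow> 0"
  proof (rule tendstoI)
    fix e :: real assume e: "e > 0"
    have "((\<lambda>(n, \<omega>). cis (t \<bullet> (Z n \<omega> - S n \<omega>))) \<longlongrightarrow> cis (t \<bullet> 0)) (whp M)"
      using null unfolding case_prod_unfold by (intro tendsto_intros)
    from tendstoD[OF this, of "e / 2"] e
    have "eventually (\<lambda>(n, \<omega>). norm (cis (t \<bullet> (Z n \<omega> - S n \<omega>)) - 1) < e / 2) (whp M)"
      by (simp add: case_prod_unfold dist_norm)
    then have "\<forall>\<^sub>F n in sequentially. \<exists>A\<in>sets M. measure M A < e / 4 \<and>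
        (\<forall>\<omega>\<in>space M - A. norm (cis (t \<bullet> (Z n \<omega> - S n \<omega>)) - 1) < e / 2)"
      unfolding eventually_whp prod.case using e by (meson divide_pos_pos zero_less_numeral)
    then show "\<forall>\<^sub>F n in sequentially.
      dist (expectation (\<lambda>\<omega>. cis (t \<bullet> Z n \<omega>)) - expectation (\<lambda>\<omega>. cis (t \<bullet> S n \<omega>))) 0 < e"
    proof eventually_elim
      case (elim n)
      then obtain A where A: "A \<in> sets M" "measure M A < e / 4"
        "\<And>\<omega>. \<omega>\<in>space M - A \<Longrightarrow> norm (cis (t \<bullet> (Z n \<omega> - S n \<omega>)) - 1) < e / 2" by blast
      have "cis (t \<bullet> Z n \<omega>) - cis (t \<bullet> S n \<omega>) = cis (t \<bullet> S n \<omega>) * (cis (t \<bullet> (Z n \<omega> - S n \<omega>)) - 1)" for \<omega>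
        by (simp add: algebra_simps cis_mult)
      then have "norm (cis (t \<bullet> Z n \<omega>) - cis (t \<bullet> S n \<omega>)) \<le> e / 2" if "\<omega>\<in>space M - A" for \<omega>
        using A(3)[OF that] by (simp add: norm_mult)
      then have "norm (expectation (\<lambda>\<omega>. cis (t \<bullet> Z n \<omega>)) - expectation (\<lambda>\<omega>. cis (t \<bullet> S n \<omega>)))
          \<le> e / 2 + (1 + 1) * prob A"
        using A e by (intro norm_integral_diff_le) auto
      with A show ?case by simp
    qed
  qed
  from tendsto_add[OF this lim[of t]]
  show "(\<lambda>n. expectation (\<lambda>\<omega>. cis (t \<bullet> Z n \<omega>))) \<longlonglongrightarrow> (\<integral>z. cis (t \<bullet> z) \<partial>Q)" by simp
qed

section \<open>Existence of Gaussian vectors\<close>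

lemma gaussian_vec_zero: "gaussian_vec 0 (return borel (0 :: real ^ 'n))"
proof -
  interpret prob_space "return borel (0 :: real ^ 'n)" by (rule prob_space_return) simp
  show ?thesis
    unfolding gaussian_vec_def
  proof (intro conjI allI)
    show "transpose (0 :: real^'n^'n) = 0" by (simp add: transpose_def vec_eq_iff)
    show "(CLINT z|return borel 0. cis (t \<bullet> z)) = complex_of_real (exp (- (t \<bullet> (0 *v t)) / 2))" for t :: "real ^ 'n"
      by (subst integral_return) auto
  qed (auto intro: prob_space_axioms)
qed

lemma gaussian_vec_add_rank_one:
  fixes b :: "real ^ 'n"
  assumes Q: "gaussian_vec V Q"
  shows "\<exists>Q'. gaussian_vec (V + (\<chi> i j. b $ i * b $ j)) Q'"
proof -
  have sets_Q [measurable_cong]: "sets Q = sets borel" and "prob_space Q" and sym: "transpose V = V"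
    and char_Q: "\<And>t. (\<integral>z. cis (t \<bullet> z) \<partial>Q) = complex_of_real (exp (- (t \<bullet> (V *v t)) / 2))"
    using Q by (auto simp: gaussian_vec_def)
  interpret Q: prob_space Q by fact
  interpret N: real_distribution std_normal_distribution by (rule real_dist_normal_dist)
  interpret QN: pair_prob_space Q std_normal_distribution ..
  let ?P = "Q \<Otimes>\<^sub>M std_normal_distribution"
  let ?h = "\<lambda>(z, x). z + x *\<^sub>R b"
  let ?V = "V + (\<chi> i j. b $ i * b $ j)"
  have "(\<integral>z. cis (t \<bullet> z) \<partial>(distr ?P borel ?h)) = complex_of_real (exp (- (t \<bullet> (?V *v t)) / 2))" for t
  proof -
    have quad: "t \<bullet> (?V *v t) = t \<bullet> (V *v t) + (t \<bullet> b)\<^sup>2"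
    proof -
      have "(\<chi> i j. b $ i * b $ j) *v t = (t \<bullet> b) *\<^sub>R b"
        by (simp add: vec_eq_iff matrix_vector_mult_def inner_vec_def sum_distrib_left mult_ac)
      then show ?thesis
        by (simp add: matrix_vector_mult_add_rdistrib inner_add_right power2_eq_square)
    qed
    have int: "integrable ?P (\<lambda>(z, x). cis (t \<bullet> z) * cis ((t \<bullet> b) * x))"
      by (rule QN.integrable_const_bound[where B=1]) (auto simp: norm_mult)
    have "(\<integral>z. cis (t \<bullet> z) \<partial>(distr ?P borel ?h)) = (\<integral>p. cis (t \<bullet> (case p of (z, x) \<Rightarrow> z + x *\<^sub>R b)) \<partial>?P)"
      by (subst integral_distr) auto
    also have "\<dots> = (\<integral>p. (case p of (z, x) \<Rightarrow> cis (t \<bullet> z) * cis ((t \<bullet> b) * x)) \<partial>?P)"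
      by (intro Bochner_Integration.integral_cong) (auto simp: cis_mult inner_add_right mult.commute)
    also have "\<dots> = (\<integral>z. (\<integral>x. cis (t \<bullet> z) * cis ((t \<bullet> b) * x) \<partial>std_normal_distribution) \<partial>Q)"
      using QN.integral_fst'[OF int] by simp
    also have "\<dots> = (\<integral>z. cis (t \<bullet> z) \<partial>Q) * char std_normal_distribution (t \<bullet> b)"
      by (simp add: char_def cis_conv_exp)
    also have "\<dots> = complex_of_real (exp (- (t \<bullet> (V *v t)) / 2) * exp (- (t \<bullet> b)\<^sup>2 / 2))"
      by (simp add: char_Q char_std_normal_distribution)
    also have "\<dots> = complex_of_real (exp (- (t \<bullet> (?V *v t)) / 2))"
      by (simp add: quad exp_add[symmetric] add_divide_distrib diff_divide_distrib)
    finally show ?thesis .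
  qed
  moreover have "transpose ?V = ?V"
    using sym by (simp add: transpose_def vec_eq_iff mult.commute)
  ultimately have "gaussian_vec ?V (distr ?P borel ?h)"
    by (auto simp: gaussian_vec_def intro!: QN.prob_space_distr)
  then show ?thesis by blast
qed

lemma quadratic_form_2:
  fixes V :: "real ^ 'n ^ 'n"
  shows "(a *\<^sub>R axis i 1 + b *\<^sub>R axis j 1) \<bullet> (V *v (a *\<^sub>R axis i 1 + b *\<^sub>R axis j 1)) =
    a\<^sup>2 * V $ i $ i + a * b * (V $ i $ j + V $ j $ i) + b\<^sup>2 * V $ j $ j"
  by (simp add: matrix_vector_right_distrib matrix_vector_mult_scaleR inner_add_left inner_add_right
      matrix_vector_mul_component inner_axis' inner_axis matrix_vector_mult_basis column_def power2_eq_square algebra_simps)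

lemma psd_diag_zero_imp_row_zero:
  fixes V :: "real ^ 'n ^ 'n"
  assumes "psd V" "transpose V = V" "V $ j $ j = 0"
  shows "V $ i $ j = 0"
proof (rule ccontr)
  assume nz: "V $ i $ j \<noteq> 0"
  have sym: "V $ j $ i = V $ i $ j"
    using assms(2) by (metis transpose_def vec_lambda_beta)
  define s where "s = - (V $ i $ i + 1) / (2 * V $ i $ j)"
  have "0 \<le> (1 *\<^sub>R axis i 1 + s *\<^sub>R axis j 1) \<bullet> (V *v (1 *\<^sub>R axis i 1 + s *\<^sub>R axis j 1))"
    using assms(1) unfolding psd_def by blast
  also have "\<dots> = V $ i $ i + 2 * s * V $ i $ j"
    unfolding quadratic_form_2 using assms(3) sym by simp
  also have "\<dots> = -1" using nz by (simp add: s_def field_simps)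
  finally show False by simp
qed

text \<open>Each step splits off a rank-one summand (Schur complement) and clears one diagonal entry.\<close>

lemma gaussian_vec_exists:
  fixes V :: "real ^ 'n ^ 'n"
  assumes "psd V" "transpose V = V"
  shows "\<exists>Q. gaussian_vec V Q"
  using assms
proof (induction "card {i. V $ i $ i \<noteq> 0}" arbitrary: V rule: less_induct)
  case less
  have sym: "V $ j $ i = V $ i $ j" for i j
    using less.prems(2) by (metis transpose_def vec_lambda_beta)
  show ?case
  proof (cases "\<exists>k. V $ k $ k \<noteq> 0")
    case False
    then have "V = 0"
      using psd_diag_zero_imp_row_zero[OF less.prems] by (simp add: vec_eq_iff)
    then show ?thesis using gaussian_vec_zero by blast
  next
    case True
    then obtain k where k: "V $ k $ k \<noteq> 0" by blast
    define v where "v = V $ k $ k"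
    have "0 \<le> (1 *\<^sub>R axis k 1 + 0 *\<^sub>R axis k 1) \<bullet> (V *v (1 *\<^sub>R axis k 1 + 0 *\<^sub>R axis k 1))"
      using less.prems(1) unfolding psd_def by blast
    then have v: "v > 0" using k unfolding quadratic_form_2 by (simp add: v_def)
    define b where "b = (\<chi> i. V $ i $ k / sqrt v)"
    define V' where "V' = V - (\<chi> i j. b $ i * b $ j)"
    have bb: "b $ i * b $ j = V $ i $ k * V $ j $ k / v" for i j
      using v by (simp add: b_def)
    have "psd V'"
      unfolding psd_def
    proof
      fix c :: "real ^ 'n"
      define s where "s = (c \<bullet> (V *v axis k 1)) / v"
      define c' where "c' = c - s *\<^sub>R axis k 1"
      have cb: "c \<bullet> (V *v axis k 1) = s * v" using v by (simp add: s_def)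
      have ck: "axis k 1 \<bullet> (V *v c) = s * v"
      proof -
        have "axis k 1 \<bullet> (V *v c) = (\<Sum>i\<in>UNIV. V $ k $ i * c $ i)"
          by (simp add: inner_axis' matrix_vector_mult_def)
        also have "\<dots> = c \<bullet> (V *v axis k 1)"
          by (auto simp: inner_vec_def matrix_vector_mult_basis column_def sym[of k] mult.commute)
        finally show ?thesis using cb by simp
      qed
      have kk: "axis k 1 \<bullet> (V *v axis k 1) = v"
        by (simp add: inner_axis' matrix_vector_mult_basis column_def v_def)
      have "0 \<le> c' \<bullet> (V *v c')" using less.prems(1) unfolding psd_def by blast
      also have "\<dots> = c \<bullet> (V *v c) - s\<^sup>2 * v"
        by (simp add: c'_def matrix_vector_mult_diff_distrib matrix_vector_mult_scaleR inner_diff_left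
            inner_diff_right cb ck kk power2_eq_square algebra_simps)
      also have "s\<^sup>2 * v = c \<bullet> ((\<chi> i j. b $ i * b $ j) *v c)"
      proof -
        have "c \<bullet> ((\<chi> i j. b $ i * b $ j) *v c) = (\<Sum>i\<in>UNIV. c $ i * (V $ i $ k)) * (\<Sum>j\<in>UNIV. c $ j * V $ j $ k) / v"
          by (simp add: inner_vec_def matrix_vector_mult_def bb sum_distrib_left sum_distrib_right
              sum_divide_distrib mult_ac)
        also have "(\<Sum>i\<in>UNIV. c $ i * (V $ i $ k)) = s * v"
          using cb by (simp add: inner_vec_def matrix_vector_mult_basis column_def)
        finally show ?thesis using v by (simp add: power2_eq_square)
      qed
      finally show "0 \<le> c \<bullet> (V' *v c)"
        by (simp add: V'_def matrix_vector_mult_diff_rdistrib inner_diff_right)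
    qed
    moreover have "transpose V' = V'"
      using sym by (simp add: V'_def transpose_def vec_eq_iff mult.commute)
    moreover have "card {i. V' $ i $ i \<noteq> 0} < card {i. V $ i $ i \<noteq> 0}"
    proof (rule psubset_card_mono)
      have "V' $ k $ k = 0" using v by (simp add: V'_def bb v_def[symmetric])
      moreover have "V' $ i $ i = 0" if "V $ i $ i = 0" for i
        using psd_diag_zero_imp_row_zero[OF less.prems that, of k] sym[of i k] that
        by (simp add: V'_def bb)
      ultimately show "{i. V' $ i $ i \<noteq> 0} \<subset> {i. V $ i $ i \<noteq> 0}" using k by blast
    qed simp
    ultimately obtain Q where "gaussian_vec V' Q" using less.hyps by blast
    from gaussian_vec_add_rank_one[OF this, of b] show ?thesis by (simp add: V'_def)
  qed
qed

section \<open>Laws of large numbers and central limit theorem\<close>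

lemma integrable_mult_square_integrable:
  fixes f g :: "'a \<Rightarrow> real"
  assumes [measurable]: "f \<in> borel_measurable M" "g \<in> borel_measurable M"
    and "integrable M (\<lambda>x. (f x)\<^sup>2)" "integrable M (\<lambda>x. (g x)\<^sup>2)"
  shows "integrable M (\<lambda>x. f x * g x)"
proof (rule Bochner_Integration.integrable_bound)
  show "integrable M (\<lambda>x. (f x)\<^sup>2 + (g x)\<^sup>2)" using assms by simp
  have "\<bar>a * b\<bar> \<le> a\<^sup>2 + b\<^sup>2" for a b :: real
    using sum_squares_bound[of "\<bar>a\<bar>" "\<bar>b\<bar>"] mult_nonneg_nonneg[of "\<bar>a\<bar>" "\<bar>b\<bar>"]
    by (simp add: abs_mult del: mult_nonneg_nonneg)
  then show "AE x in M. norm (f x * g x) \<le> norm ((f x)\<^sup>2 + (g x)\<^sup>2)" by simp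
qed simp

locale iid_sequence = prob_space M for M :: "'a measure" +
  fixes D :: "nat \<Rightarrow> 'a \<Rightarrow> 'b::topological_space"
  assumes indep: "indep_vars (\<lambda>_. borel) D UNIV"
    and ident: "\<And>i. distr M borel (D i) = distr M borel (D 0)"
begin

lemma D_measurable [measurable]: "D i \<in> borel_measurable M"
  using indep by (simp add: indep_vars_def)

lemma indep_vars_comp:
  assumes "f \<in> borel_measurable borel"
  shows "indep_vars (\<lambda>_. borel) (\<lambda>i \<omega>. f (D i \<omega>)) I"
  by (rule indep_vars_compose2[OF indep_vars_subset[OF indep]]) (use assms in auto)

lemma expectation_comp:
  fixes f :: "'b \<Rightarrow> 'c::{banach, second_countable_topology}"
  assumes [measurable]: "f \<in> borel_measurable borel"
  shows "expectation (\<lambda>\<omega>. f (D i \<omega>)) = expectation (\<lambda>\<omega>. f (D 0 \<omega>))"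
  by (metis assms integral_distr[OF D_measurable] ident)

lemma integrable_comp:
  fixes f :: "'b \<Rightarrow> 'c::{banach, second_countable_topology}"
  assumes [measurable]: "f \<in> borel_measurable borel"
  shows "integrable M (\<lambda>\<omega>. f (D i \<omega>)) \<longleftrightarrow> integrable M (\<lambda>\<omega>. f (D 0 \<omega>))"
  by (metis assms integrable_distr_eq[OF D_measurable] ident)

lemma expectation_mult_comp:
  fixes f :: "'b \<Rightarrow> real"
  assumes [measurable]: "f \<in> borel_measurable borel" and int: "integrable M (\<lambda>\<omega>. f (D 0 \<omega>))"
    and "i \<noteq> j"
  shows "expectation (\<lambda>\<omega>. f (D i \<omega>) * f (D j \<omega>)) = (expectation (\<lambda>\<omega>. f (D 0 \<omega>)))\<^sup>2"
    and "integrable M (\<lambda>\<omega>. f (D i \<omega>) * f (D j \<omega>))"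
proof -
  have I: "indep_vars (\<lambda>_. borel) (\<lambda>i \<omega>. f (D i \<omega>)) {i, j}"
    by (rule indep_vars_comp) simp
  have i: "integrable M (\<lambda>\<omega>. f (D k \<omega>))" for k using int integrable_comp[of f k] by simp
  show "expectation (\<lambda>\<omega>. f (D i \<omega>) * f (D j \<omega>)) = (expectation (\<lambda>\<omega>. f (D 0 \<omega>)))\<^sup>2"
    using indep_vars_lebesgue_integral[OF _ I] i \<open>i \<noteq> j\<close> expectation_comp[of f i] expectation_comp[of f j]
    by (simp add: power2_eq_square)
  show "integrable M (\<lambda>\<omega>. f (D i \<omega>) * f (D j \<omega>))"
    using indep_vars_integrable[OF _ I] i \<open>i \<noteq> j\<close> by simp
qed

lemma expectation_sum_square:
  fixes f :: "'b \<Rightarrow> real"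
  assumes [measurable]: "f \<in> borel_measurable borel" and sq: "integrable M (\<lambda>\<omega>. (f (D 0 \<omega>))\<^sup>2)"
    and mean: "expectation (\<lambda>\<omega>. f (D 0 \<omega>)) = 0"
  shows "expectation (\<lambda>\<omega>. (\<Sum>i<n. f (D i \<omega>))\<^sup>2) = n * expectation (\<lambda>\<omega>. (f (D 0 \<omega>))\<^sup>2)"
    and "integrable M (\<lambda>\<omega>. (\<Sum>i<n. f (D i \<omega>))\<^sup>2)"
proof -
  have i0: "integrable M (\<lambda>\<omega>. f (D 0 \<omega>))"
    by (rule square_integrable_imp_integrable[OF _ sq]) simp
  have e: "(\<Sum>i<n. f (D i \<omega>))\<^sup>2 = (\<Sum>i<n. \<Sum>j<n. f (D i \<omega>) * f (D j \<omega>))" for \<omega>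
    by (simp add: power2_eq_square sum_product)
  have i: "integrable M (\<lambda>\<omega>. f (D i \<omega>) * f (D j \<omega>))" for i j
  proof (cases "i = j")
    case True
    then show ?thesis using sq integrable_comp[of "\<lambda>x. (f x)\<^sup>2" i] by (simp add: power2_eq_square)
  qed (rule expectation_mult_comp(2)[OF _ i0], auto)
  have v: "expectation (\<lambda>\<omega>. f (D i \<omega>) * f (D j \<omega>)) =
      (if i = j then expectation (\<lambda>\<omega>. (f (D 0 \<omega>))\<^sup>2) else 0)" for i j
    using expectation_mult_comp(1)[OF _ i0, of i j] mean expectation_comp[of "\<lambda>x. (f x)\<^sup>2" i]
    by (auto simp: power2_eq_square)
  show "integrable M (\<lambda>\<omega>. (\<Sum>i<n. f (D i \<omega>))\<^sup>2)"
    unfolding e using i by auto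
  show "expectation (\<lambda>\<omega>. (\<Sum>i<n. f (D i \<omega>))\<^sup>2) = n * expectation (\<lambda>\<omega>. (f (D 0 \<omega>))\<^sup>2)"
    unfolding e using i v by simp
qed

lemma bounded_in_prob_normalized_sum:
  fixes f :: "'b \<Rightarrow> real"
  assumes [measurable]: "f \<in> borel_measurable borel" and sq: "integrable M (\<lambda>\<omega>. (f (D 0 \<omega>))\<^sup>2)"
    and mean: "expectation (\<lambda>\<omega>. f (D 0 \<omega>)) = 0"
  shows "bounded_in_prob M (\<lambda>n \<omega>. (\<Sum>i<n. f (D i \<omega>)) / sqrt (real n))"
  unfolding bounded_in_prob_def
proof (intro allI impI)
  fix \<delta> :: real assume \<delta>: "\<delta> > 0"
  define v where "v = expectation (\<lambda>\<omega>. (f (D 0 \<omega>))\<^sup>2)"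
  have v: "v \<ge> 0" by (simp add: v_def)
  define L where "L = sqrt ((v + 1) / \<delta>)"
  have L: "L > 0" "L\<^sup>2 = (v + 1) / \<delta>" using v \<delta> by (auto simp: L_def)
  let ?S = "\<lambda>n \<omega>. (\<Sum>i<n. f (D i \<omega>)) / sqrt (real n)"
  have "\<forall>\<^sub>F n in sequentially. \<exists>A\<in>sets M. prob A < \<delta> \<and> (\<forall>\<omega>\<in>space M - A. norm (?S n \<omega>) \<le> L)"
  proof (rule eventually_sequentiallyI)
    fix n :: nat assume n: "n \<ge> 1"
    let ?A = "{\<omega>\<in>space M. L\<^sup>2 \<le> (?S n \<omega>)\<^sup>2}"
    have eq: "(?S n \<omega>)\<^sup>2 = (\<Sum>i<n. f (D i \<omega>))\<^sup>2 / n" for \<omega> by (simp add: power_divide)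
    have "prob ?A \<le> expectation (\<lambda>\<omega>. (?S n \<omega>)\<^sup>2) / L\<^sup>2"
      using zero_less_power[OF L(1), of 2] expectation_sum_square(2)[OF assms, of n] unfolding eq
      by (intro integral_Markov_inequality_measure[where A="{}"]) auto
    also have "\<dots> = v / L\<^sup>2"
      using expectation_sum_square(1)[OF assms, of n] n by (simp add: eq v_def)
    also have "\<dots> < \<delta>" using L v \<delta> by (simp add: field_simps)
    finally have "prob ?A < \<delta>" .
    moreover have "norm (?S n \<omega>) \<le> L" if "\<omega> \<in> space M - ?A" for \<omega>
    proof -
      have "(?S n \<omega>)\<^sup>2 \<le> L\<^sup>2" using that by auto
      then show ?thesis using L by (metis abs_le_square_iff abs_of_pos real_norm_def)
    qed
    moreover have "?A \<in> sets M" by simp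
    ultimately show "\<exists>A\<in>sets M. prob A < \<delta> \<and> (\<forall>\<omega>\<in>space M - A. norm (?S n \<omega>) \<le> L)"
      by blast
  qed
  then show "\<exists>L. \<forall>\<^sub>F n in sequentially. \<exists>A\<in>sets M. prob A < \<delta> \<and> (\<forall>\<omega>\<in>space M - A. norm (?S n \<omega>) \<le> L)"
    by blast
qed

text \<open>Truncating at a fixed level \<open>c\<close> suffices: the bounded part has variance of order \<open>1/n\<close>,
  and the tail is uniformly small in \<open>L\<^sup>1\<close>.\<close>

theorem weak_law_of_large_numbers:
  fixes f :: "'b \<Rightarrow> real"
  assumes [measurable]: "f \<in> borel_measurable borel" and int: "integrable M (\<lambda>\<omega>. f (D 0 \<omega>))"
  shows "((\<lambda>(n, \<omega>). (\<Sum>i<n. f (D i \<omega>)) / real n) \<longlongrightarrow> expectation (\<lambda>\<omega>. f (D 0 \<omega>))) (whp M)"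
proof (rule tendstoI)
  fix e :: real assume e: "e > 0"
  let ?m = "expectation (\<lambda>\<omega>. f (D 0 \<omega>))"
  define lo where "lo c x = (if \<bar>f x\<bar> \<le> c then f x else 0)" for c x
  define hi where "hi c x = (if \<bar>f x\<bar> \<le> c then 0 else f x)" for c x
  have [measurable]: "lo c \<in> borel_measurable borel" "hi c \<in> borel_measurable borel" for c
    unfolding lo_def hi_def by measurable
  have fsplit: "f x = lo c x + hi c x" for c x by (simp add: lo_def hi_def)
  have lo_int: "integrable M (\<lambda>\<omega>. lo c (D 0 \<omega>))" for c
    by (rule Bochner_Integration.integrable_bound[OF int]) (auto simp: lo_def)
  have hi_int0: "integrable M (\<lambda>\<omega>. hi c (D 0 \<omega>))" for c
    by (rule Bochner_Integration.integrable_bound[OF int]) (auto simp: hi_def)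
  have hi_int: "integrable M (\<lambda>\<omega>. hi c (D i \<omega>))" for c i
    using hi_int0 integrable_comp[of "hi c" i] by simp
  have tail: "(\<lambda>k. expectation (\<lambda>\<omega>. \<bar>hi (real k) (D 0 \<omega>)\<bar>)) \<longlonglongrightarrow> expectation (\<lambda>\<omega>. 0)"
  proof (rule integral_dominated_convergence[where w="\<lambda>\<omega>. \<bar>f (D 0 \<omega>)\<bar>"])
    have "(\<lambda>k. \<bar>hi (real k) x\<bar>) \<longlonglongrightarrow> 0" for x
    proof (rule tendsto_eventually)
      obtain k0 :: nat where "\<bar>f x\<bar> \<le> real k0" using real_arch_simple by blast
      then show "\<forall>\<^sub>F k in sequentially. \<bar>hi (real k) x\<bar> = 0"
        by (intro eventually_sequentiallyI[of k0]) (auto simp: hi_def)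
    qed
    then show "AE \<omega> in M. (\<lambda>k. \<bar>hi (real k) (D 0 \<omega>)\<bar>) \<longlonglongrightarrow> 0" by simp
  qed (use int in \<open>auto simp: hi_def\<close>)
  show "eventually (\<lambda>x. dist (case x of (n, \<omega>) \<Rightarrow> (\<Sum>i<n. f (D i \<omega>)) / real n) ?m < e) (whp M)"
    unfolding eventually_whp prod.case
  proof (intro allI impI)
    fix \<delta> :: real assume \<delta>: "\<delta> > 0"
    define \<tau> where "\<tau> = min (e / 4) (e * \<delta> / 16)"
    have \<tau>: "\<tau> > 0" "\<tau> \<le> e / 4" "\<tau> \<le> e * \<delta> / 16" using e \<delta> by (auto simp: \<tau>_def)
    from order_tendstoD(2)[OF tail, of \<tau>] \<tau> obtain k where
      k: "expectation (\<lambda>\<omega>. \<bar>hi (real k) (D 0 \<omega>)\<bar>) < \<tau>"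
      by (auto simp: eventually_sequentially)
    define c where "c = real k"
    define ml where "ml = expectation (\<lambda>\<omega>. lo c (D 0 \<omega>))"
    have m: "?m = ml + expectation (\<lambda>\<omega>. hi c (D 0 \<omega>))"
      unfolding ml_def fsplit[of _ c] using lo_int hi_int0 by simp
    have mh: "\<bar>expectation (\<lambda>\<omega>. hi c (D 0 \<omega>))\<bar> \<le> e / 4"
      using integral_abs_bound[of M "\<lambda>\<omega>. hi c (D 0 \<omega>)"] k \<tau> unfolding c_def by linarith
    let ?A = "\<lambda>n. {\<omega>\<in>space M. e / 4 \<le> (\<Sum>i<n. \<bar>hi c (D i \<omega>)\<bar>) / n}"
    have A: "prob (?A n) < \<delta> / 2" for n
    proof -
      have "prob (?A n) \<le> expectation (\<lambda>\<omega>. (\<Sum>i<n. \<bar>hi c (D i \<omega>)\<bar>) / n) / (e / 4)"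
        using e hi_int by (intro integral_Markov_inequality_measure[where A="{}"]) (auto intro!: divide_nonneg_nonneg sum_nonneg)
      also have "expectation (\<lambda>\<omega>. (\<Sum>i<n. \<bar>hi c (D i \<omega>)\<bar>) / n) = (\<Sum>i<n. expectation (\<lambda>\<omega>. \<bar>hi c (D i \<omega>)\<bar>)) / n"
        using hi_int by simp
      also have "\<dots> = (\<Sum>i<n. expectation (\<lambda>\<omega>. \<bar>hi c (D 0 \<omega>)\<bar>)) / n"
        by (intro arg_cong2[where f="(/)"] sum.cong refl expectation_comp) simp
      also have "\<dots> / (e / 4) \<le> \<tau> / (e / 4)"
        using k e \<tau> by (intro divide_right_mono) (auto simp: c_def)
      also have "\<dots> < \<delta> / 2" using \<tau> e \<delta> by (simp add: field_simps)
      finally show ?thesis .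
    qed
    have lom: "(\<lambda>x. lo c x - ml) \<in> borel_measurable borel" by simp
    have lo_sq: "integrable M (\<lambda>\<omega>. (lo c (D 0 \<omega>) - ml)\<^sup>2)"
    proof (rule integrable_const_bound[where B="(c + \<bar>ml\<bar>)\<^sup>2"])
      have "\<bar>lo c x - ml\<bar> \<le> \<bar>c + \<bar>ml\<bar>\<bar>" for x
        using abs_triangle_ineq4[of "lo c x" ml] by (auto simp: lo_def c_def)
      then have "(lo c x - ml)\<^sup>2 \<le> (c + \<bar>ml\<bar>)\<^sup>2" for x
        by (simp only: abs_le_square_iff)
      then show "AE \<omega> in M. norm ((lo c (D 0 \<omega>) - ml)\<^sup>2) \<le> (c + \<bar>ml\<bar>)\<^sup>2" by simp
    qed simp
    have lo_mean: "expectation (\<lambda>\<omega>. lo c (D 0 \<omega>) - ml) = 0"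
      using lo_int by (simp add: ml_def prob_space)
    have bp: "bounded_in_prob M (\<lambda>n \<omega>. (\<Sum>i<n. lo c (D i \<omega>) - ml) / sqrt (real n))"
      by (rule bounded_in_prob_normalized_sum[OF lom lo_sq lo_mean])
    have "((\<lambda>(n, \<omega>). 1 / sqrt (real n)) \<longlongrightarrow> 0) (whp M)"
    proof (rule tendstoI)
      fix r :: real assume "r > 0"
      have "(\<lambda>n. 1 / sqrt (real n)) \<longlonglongrightarrow> 0"
        by (intro real_tendsto_divide_at_top[OF tendsto_const] filterlim_compose[OF sqrt_at_top] filterlim_real_sequentially)
      from tendstoD[OF this \<open>r > 0\<close>]
      show "eventually (\<lambda>x. dist (case x of (n, \<omega>) \<Rightarrow> 1 / sqrt (real n)) 0 < r) (whp M)"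
        by (intro eventually_whp_surely) simp
    qed
    from tendsto_null_mult_bounded_in_prob[OF this bp]
    have "((\<lambda>(n, \<omega>). (\<Sum>i<n. lo c (D i \<omega>) - ml) / real n) \<longlongrightarrow> 0) (whp M)"
      by simp
    from tendstoD[OF this, of "e / 4"] e
    have "eventually (\<lambda>(n, \<omega>). \<bar>(\<Sum>i<n. lo c (D i \<omega>) - ml) / real n\<bar> < e / 4) (whp M)"
      by (simp add: case_prod_unfold)
    then have "\<forall>\<^sub>F n in sequentially. \<exists>B\<in>sets M. prob B < \<delta> / 2 \<and>
        (\<forall>\<omega>\<in>space M - B. \<bar>(\<Sum>i<n. lo c (D i \<omega>) - ml) / real n\<bar> < e / 4)"
      unfolding eventually_whp prod.case using \<delta> by (meson half_gt_zero)
    then show "\<forall>\<^sub>F n in sequentially. \<exists>A\<in>sets M. prob A < \<delta> \<and>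
        (\<forall>\<omega>\<in>space M - A. dist ((\<Sum>i<n. f (D i \<omega>)) / real n) ?m < e)"
      using eventually_ge_at_top[of 1]
    proof eventually_elim
      case (elim n)
      then obtain B where B: "B \<in> sets M" "prob B < \<delta> / 2"
        "\<And>\<omega>. \<omega>\<in>space M - B \<Longrightarrow> \<bar>(\<Sum>i<n. lo c (D i \<omega>) - ml) / real n\<bar> < e / 4" by blast
      have "dist ((\<Sum>i<n. f (D i \<omega>)) / real n) ?m < e" if w: "\<omega> \<in> space M - (?A n \<union> B)" for \<omega>
      proof -
        have "(\<Sum>i<n. f (D i \<omega>)) / real n - ml
            = (\<Sum>i<n. lo c (D i \<omega>) - ml) / real n + (\<Sum>i<n. hi c (D i \<omega>)) / real n"
          using elim by (simp add: fsplit[of _ c] sum.distrib sum_subtractf field_simps)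
        moreover have "\<bar>(\<Sum>i<n. hi c (D i \<omega>)) / real n\<bar> \<le> (\<Sum>i<n. \<bar>hi c (D i \<omega>)\<bar>) / n"
          by (auto intro!: divide_right_mono sum_abs simp: abs_divide)
        moreover have "(\<Sum>i<n. \<bar>hi c (D i \<omega>)\<bar>) / n < e / 4" using w by auto
        moreover have "\<bar>(\<Sum>i<n. lo c (D i \<omega>) - ml) / real n\<bar> < e / 4" using w B(3) by auto
        ultimately show ?thesis using m mh e unfolding dist_real_def by linarith
      qed
      moreover have "prob (?A n \<union> B) < \<delta>"
        using measure_Un_le[of "?A n" M B] A[of n] B by simp
      ultimately show ?case using B(1) by (intro bexI[of _ "?A n \<union> B"]) auto
    qed
  qed
qed

lemma char_normalized_sum_tendsto:
  fixes f :: "'b \<Rightarrow> real"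
  assumes fm [measurable]: "f \<in> borel_measurable borel" and sq: "integrable M (\<lambda>\<omega>. (f (D 0 \<omega>))\<^sup>2)"
    and mean: "expectation (\<lambda>\<omega>. f (D 0 \<omega>)) = 0"
  shows "(\<lambda>n. expectation (\<lambda>\<omega>. cis ((\<Sum>i<n. f (D i \<omega>)) / sqrt (real n))))
    \<longlonglongrightarrow> complex_of_real (exp (- expectation (\<lambda>\<omega>. (f (D 0 \<omega>))\<^sup>2) / 2))"
proof (cases "expectation (\<lambda>\<omega>. (f (D 0 \<omega>))\<^sup>2) = 0")
  case True
  have "AE \<omega> in M. f (D i \<omega>) = 0" for i
  proof -
    have "integrable M (\<lambda>\<omega>. (f (D i \<omega>))\<^sup>2)" "expectation (\<lambda>\<omega>. (f (D i \<omega>))\<^sup>2) = 0"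
      using sq True integrable_comp[of "\<lambda>x. (f x)\<^sup>2" i] expectation_comp[of "\<lambda>x. (f x)\<^sup>2" i] by auto
    then show ?thesis using integral_nonneg_eq_0_iff_AE[of M "\<lambda>\<omega>. (f (D i \<omega>))\<^sup>2"] by simp
  qed
  then have "AE \<omega> in M. \<forall>i. f (D i \<omega>) = 0" by (simp add: AE_all_countable)
  then have "expectation (\<lambda>\<omega>. cis ((\<Sum>i<n. f (D i \<omega>)) / sqrt (real n))) = expectation (\<lambda>\<omega>. 1)" for n
    by (intro integral_cong_AE) auto
  then show ?thesis using True by (simp add: prob_space)
next
  case False
  define \<sigma> where "\<sigma> = sqrt (expectation (\<lambda>\<omega>. (f (D 0 \<omega>))\<^sup>2))"
  have \<sigma>: "\<sigma> > 0" "\<sigma>\<^sup>2 = expectation (\<lambda>\<omega>. (f (D 0 \<omega>))\<^sup>2)"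
    using False integral_nonneg_AE[of "\<lambda>\<omega>. (f (D 0 \<omega>))\<^sup>2" M] by (auto simp: \<sigma>_def less_le)
  let ?S = "\<lambda>n x. (\<Sum>i<n. f (D i x)) / sqrt (real n * \<sigma>\<^sup>2)"
  have ex0: "expectation (\<lambda>\<omega>. f (D n \<omega>)) = 0" for n using mean expectation_comp[OF fm, of n] by simp
  have "weak_conv_m (\<lambda>n. distr M borel (?S n)) std_normal_distribution"
  proof (rule central_limit_theorem_zero_mean[where X="\<lambda>i \<omega>. f (D i \<omega>)" and \<mu>="distr M borel (\<lambda>\<omega>. f (D 0 \<omega>))"])
    show "indep_vars (\<lambda>i. borel) (\<lambda>i \<omega>. f (D i \<omega>)) UNIV" by (rule indep_vars_comp) simp
    show "integrable M (\<lambda>x. (f (D n x))\<^sup>2)" for n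
      using sq integrable_comp[of "\<lambda>x. (f x)\<^sup>2" n] by simp
    show "expectation (\<lambda>x. (f (D n x) - expectation (\<lambda>\<omega>. f (D n \<omega>)))\<^sup>2) = \<sigma>\<^sup>2" for n
      using expectation_comp[of "\<lambda>x. (f x)\<^sup>2" n] by (simp add: ex0 \<sigma>)
    show "distr M borel (\<lambda>\<omega>. f (D n \<omega>)) = distr M borel (\<lambda>\<omega>. f (D 0 \<omega>))" for n
      using distr_distr[OF fm D_measurable, of n] distr_distr[OF fm D_measurable, of 0] ident[of n]
      by (simp add: comp_def)
  qed (use \<sigma> ex0 in auto)
  from levy_continuity1[OF _ real_dist_normal_dist this, of \<sigma>]
  have "(\<lambda>n. char (distr M borel (?S n)) \<sigma>) \<longlonglongrightarrow> complex_of_real (exp (- \<sigma>\<^sup>2 / 2))"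
    by (simp add: char_std_normal_distribution real_distribution_distr)
  moreover have "char (distr M borel (?S n)) \<sigma> = expectation (\<lambda>\<omega>. cis ((\<Sum>i<n. f (D i \<omega>)) / sqrt (real n)))" for n
    unfolding char_def using \<sigma>(1)
    by (subst integral_distr)
      (auto simp: real_sqrt_mult cis_conv_exp)
  ultimately show ?thesis by (simp add: \<sigma>(2))
qed

theorem is_avar_asymptotically_linear:
  fixes \<xi> :: "'b \<Rightarrow> real ^ 'n" and Z :: "nat \<Rightarrow> 'a \<Rightarrow> real ^ 'n"
  assumes \<xi>m [measurable]: "\<xi> \<in> borel_measurable borel"
    and sq: "\<And>g. integrable M (\<lambda>\<omega>. (\<xi> (D 0 \<omega>) $ g)\<^sup>2)"
    and mean: "\<And>g. expectation (\<lambda>\<omega>. \<xi> (D 0 \<omega>) $ g) = 0"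
    and Zm: "\<And>n. Z n \<in> borel_measurable M"
    and null: "\<And>g. ((\<lambda>(n, \<omega>). Z n \<omega> $ g - (\<Sum>i<n. \<xi> (D i \<omega>) $ g) / sqrt (real n)) \<longlongrightarrow> 0) (whp M)"
  shows "is_avar M Z (\<chi> g h. expectation (\<lambda>\<omega>. \<xi> (D 0 \<omega>) $ g * \<xi> (D 0 \<omega>) $ h))"
proof -
  let ?V = "(\<chi> g h. expectation (\<lambda>\<omega>. \<xi> (D 0 \<omega>) $ g * \<xi> (D 0 \<omega>) $ h)) :: real ^ 'n ^ 'n"
  have nth [measurable]: "(\<lambda>x. \<xi> x $ g) \<in> borel_measurable borel" for g
    by (rule borel_measurable_continuous_on[OF _ \<xi>m]) (intro continuous_intros)
  have i: "integrable M (\<lambda>\<omega>. \<xi> (D 0 \<omega>) $ g)" for g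
    by (rule square_integrable_imp_integrable[OF _ sq]) simp
  have i2: "integrable M (\<lambda>\<omega>. \<xi> (D 0 \<omega>) $ g * \<xi> (D 0 \<omega>) $ h)" for g h
    by (intro integrable_mult_square_integrable sq) auto
  have tsq: "(t \<bullet> x)\<^sup>2 = (\<Sum>g\<in>UNIV. \<Sum>h\<in>UNIV. t $ g * t $ h * (x $ g * x $ h))" for t x :: "real ^ 'n"
    by (simp add: inner_vec_def power2_eq_square sum_product mult_ac)
  have quad: "t \<bullet> (?V *v t) = expectation (\<lambda>\<omega>. (t \<bullet> \<xi> (D 0 \<omega>))\<^sup>2)" for t
    unfolding tsq using i2
    by (simp add: inner_vec_def matrix_vector_mult_def sum_distrib_left mult_ac)
  have t_sq: "integrable M (\<lambda>\<omega>. (t \<bullet> \<xi> (D 0 \<omega>))\<^sup>2)" for t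
    unfolding tsq using i2 by simp
  have t_mean: "expectation (\<lambda>\<omega>. t \<bullet> \<xi> (D 0 \<omega>)) = 0" for t
    using i mean by (simp add: inner_vec_def)
  have "psd ?V" unfolding psd_def quad by (intro allI integral_nonneg_AE) simp
  moreover have "transpose ?V = ?V" by (simp add: transpose_def vec_eq_iff mult.commute)
  ultimately obtain Q where Q: "gaussian_vec ?V Q" using gaussian_vec_exists by blast
  define S where "S n \<omega> = (1 / sqrt (real n)) *\<^sub>R (\<Sum>i<n. \<xi> (D i \<omega>))" for n \<omega>
  have tS: "t \<bullet> S n \<omega> = (\<Sum>i<n. t \<bullet> \<xi> (D i \<omega>)) / sqrt (real n)" for t n \<omega>
    by (simp add: S_def inner_sum_right)
  have Sg: "S n \<omega> $ g = (\<Sum>i<n. \<xi> (D i \<omega>) $ g) / sqrt (real n)" for g n \<omega>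
    by (simp add: S_def)
  have "conv_in_distr M Z Q"
  proof (rule conv_in_distr_asymptotically_equivalent[where S=S])
    show "prob_space M" by (rule prob_space_axioms)
    show "prob_space Q" "sets Q = sets borel" using Q by (auto simp: gaussian_vec_def)
    show "Z n \<in> borel_measurable M" for n by (rule Zm)
    show "S n \<in> borel_measurable M" for n unfolding S_def by measurable
    show "(\<lambda>n. expectation (\<lambda>\<omega>. cis (t \<bullet> S n \<omega>))) \<longlonglongrightarrow> (\<integral>z. cis (t \<bullet> z) \<partial>Q)" for t
    proof -
      have "(\<integral>z. cis (t \<bullet> z) \<partial>Q) = complex_of_real (exp (- expectation (\<lambda>\<omega>. (t \<bullet> \<xi> (D 0 \<omega>))\<^sup>2) / 2))"
        using Q unfolding gaussian_vec_def quad by blast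
      then show ?thesis
        unfolding tS using char_normalized_sum_tendsto[OF _ t_sq t_mean, of t] by simp
    qed
    show "((\<lambda>(n, \<omega>). Z n \<omega> - S n \<omega>) \<longlongrightarrow> 0) (whp M)"
      using null unfolding Sg[symmetric] case_prod_unfold by (intro vec_tendstoI) simp
    show "bounded_in_prob M S"
      unfolding bounded_in_prob_def
    proof (intro allI impI)
      fix \<delta> :: real assume \<delta>: "\<delta> > 0"
      define d where "d = \<delta> / CARD('n)"
      have d: "d > 0" using \<delta> by (simp add: d_def)
      have "\<forall>g. \<exists>L. \<forall>\<^sub>F n in sequentially. \<exists>A\<in>sets M. prob A < d \<and> (\<forall>\<omega>\<in>space M - A. norm (S n \<omega> $ g) \<le> L)"
        using bounded_in_prob_normalized_sum[OF nth sq mean] d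
        unfolding bounded_in_prob_def Sg by blast
      from choice[OF this] obtain L where L: "\<And>g. \<forall>\<^sub>F n in sequentially.
          \<exists>A\<in>sets M. prob A < d \<and> (\<forall>\<omega>\<in>space M - A. norm (S n \<omega> $ g) \<le> L g)" by blast
      have "\<forall>\<^sub>F n in sequentially. \<forall>g\<in>UNIV.
          \<exists>A\<in>sets M. prob A < d \<and> (\<forall>\<omega>\<in>space M - A. norm (S n \<omega> $ g) \<le> L g)"
        by (rule eventually_ball_finite) (use L in auto)
      then have "\<forall>\<^sub>F n in sequentially. \<exists>A\<in>sets M. prob A < \<delta> \<and>
          (\<forall>\<omega>\<in>space M - A. norm (S n \<omega>) \<le> (\<Sum>g\<in>UNIV. L g))"
      proof eventually_elim
        case (elim n)
        then have "\<forall>g. \<exists>A. A \<in> sets M \<and> prob A < d \<and> (\<forall>\<omega>\<in>space M - A. norm (S n \<omega> $ g) \<le> L g)"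
          by blast
        from choice[OF this] obtain A where A: "\<And>g. A g \<in> sets M" "\<And>g. prob (A g) < d"
          "\<And>g \<omega>. \<omega>\<in>space M - A g \<Longrightarrow> norm (S n \<omega> $ g) \<le> L g"
          by blast
        have "prob (\<Union>g\<in>UNIV. A g) \<le> (\<Sum>g\<in>UNIV. prob (A g))"
          using A by (intro finite_measure_subadditive_finite) auto
        also have "\<dots> < (\<Sum>g\<in>(UNIV :: 'n set). d)" using A by (intro sum_strict_mono) auto
        also have "\<dots> = \<delta>" by (simp add: d_def)
        finally have "prob (\<Union>g\<in>UNIV. A g) < \<delta>" .
        moreover have "norm (S n \<omega>) \<le> (\<Sum>g\<in>UNIV. L g)" if "\<omega> \<in> space M - (\<Union>g\<in>UNIV. A g)" for \<omega>
          using norm_le_l1_cart[of "S n \<omega>"] that A(3)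
          by (intro order_trans[OF norm_le_l1_cart] sum_mono) auto
        ultimately show ?case using A(1) by (intro bexI[of _ "\<Union>g\<in>UNIV. A g"]) auto
      qed
      then show "\<exists>L. \<forall>\<^sub>F n in sequentially. \<exists>A\<in>sets M. prob A < \<delta> \<and> (\<forall>\<omega>\<in>space M - A. norm (S n \<omega>) \<le> L)"
        by blast
    qed
  qed
  with Q show ?thesis unfolding is_avar_def by blast
qed

end

section \<open>Continuity and measurability of solving linear systems\<close>

lemma borel_measurable_vec_nth [measurable (raw)]:
  fixes f :: "'a \<Rightarrow> real ^ 'n"
  assumes "f \<in> borel_measurable M"
  shows "(\<lambda>x. f x $ i) \<in> borel_measurable M"
  by (rule borel_measurable_continuous_on[OF _ assms]) (intro continuous_intros)

lemma borel_measurable_vecI: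
  fixes f :: "'a \<Rightarrow> real ^ 'n"
  assumes "\<And>i. (\<lambda>x. f x $ i) \<in> borel_measurable M"
  shows "f \<in> borel_measurable M"
  unfolding borel_measurable_euclidean_space[of f]
  using assms by (auto simp: Basis_vec_def inner_axis)

lemma borel_measurable_det:
  fixes A :: "'a \<Rightarrow> real ^ 'n ^ 'n"
  assumes [measurable]: "\<And>i j. (\<lambda>x. A x $ i $ j) \<in> borel_measurable M"
  shows "(\<lambda>x. det (A x)) \<in> borel_measurable M"
  unfolding det_def by measurable

lemma tendsto_det:
  fixes A :: "'a \<Rightarrow> real ^ 'n ^ 'n"
  assumes "(A \<longlongrightarrow> L) F"
  shows "((\<lambda>x. det (A x)) \<longlongrightarrow> det L) F"
  unfolding det_def by (intro tendsto_intros assms)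

definition cramer_solution :: "real ^ 'n ^ 'n \<Rightarrow> real ^ 'n \<Rightarrow> real ^ 'n" where
  "cramer_solution A b = (\<chi> k. det (\<chi> i j. if j = k then b $ i else A $ i $ j) / det A)"

lemma tendsto_cramer_solution:
  assumes A: "(A \<longlongrightarrow> A0) F" and b: "(b \<longlongrightarrow> b0) F" and "det A0 \<noteq> 0"
  shows "((\<lambda>x. cramer_solution (A x) (b x)) \<longlongrightarrow> cramer_solution A0 b0) F"
  unfolding cramer_solution_def
proof (intro tendsto_vec_lambda tendsto_divide tendsto_det A)
  fix k i j
  show "((\<lambda>x. if j = k then b x $ i else A x $ i $ j) \<longlongrightarrow> (if j = k then b0 $ i else A0 $ i $ j)) F"
    using A b by (cases "j = k") (auto intro!: tendsto_intros)
qed fact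

lemma matrix_inv_right_inverse:
  assumes "invertible A"
  shows "A ** matrix_inv A = mat 1"
  using someI_ex[OF assms[unfolded invertible_def]] by (simp add: matrix_inv_def)

lemma matrix_inv_mult_eq_cramer_solution:
  fixes A :: "real ^ 'n ^ 'n"
  assumes "det A \<noteq> 0"
  shows "matrix_inv A *v b = cramer_solution A b"
proof -
  have "A *v (matrix_inv A *v b) = b"
    using assms by (simp add: matrix_vector_mul_assoc matrix_inv_right_inverse invertible_det_nz)
  then show ?thesis using cramer[OF assms] unfolding cramer_solution_def by blast
qed

lemma matrix_inv_scaleR_mult_scaleR:
  fixes A :: "real ^ 'n ^ 'n"
  assumes "c \<noteq> 0" "det A \<noteq> 0"
  shows "matrix_inv (c *\<^sub>R A) *v (c *\<^sub>R b) = cramer_solution A b"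
proof -
  have "c *\<^sub>R A = (\<chi> i. c *s (A $ i))" by (simp add: vec_eq_iff)
  then have "det (c *\<^sub>R A) \<noteq> 0" using assms by (simp add: det_rows_mul)
  then have "(c *\<^sub>R A) *v (matrix_inv (c *\<^sub>R A) *v (c *\<^sub>R b)) = c *\<^sub>R b"
    by (simp add: matrix_vector_mul_assoc matrix_inv_right_inverse invertible_det_nz)
  then have "A *v (matrix_inv (c *\<^sub>R A) *v (c *\<^sub>R b)) = b"
    using assms by (simp flip: scaleR_matrix_vector_assoc)
  then show ?thesis using cramer[OF assms(2)] unfolding cramer_solution_def by blast
qed

text \<open>On singular matrices \<open>matrix_inv\<close> is one fixed, arbitrary matrix, so measurability survives.\<close>

lemma borel_measurable_matrix_inv_mult:
  fixes A :: "'a \<Rightarrow> real ^ 'n ^ 'n" and b :: "'a \<Rightarrow> real ^ 'n"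
  assumes A [measurable]: "\<And>i j. (\<lambda>x. A x $ i $ j) \<in> borel_measurable M"
    and b [measurable]: "\<And>i. (\<lambda>x. b x $ i) \<in> borel_measurable M"
  shows "(\<lambda>x. matrix_inv (A x) *v b x) \<in> borel_measurable M"
proof (rule borel_measurable_vecI)
  fix k
  define C :: "real ^ 'n ^ 'n" where "C = (SOME _. False)"
  have "(\<lambda>x. if j = k then b x $ i else A x $ i $ j) \<in> borel_measurable M" for i j
    by (cases "j = k") auto
  then have [measurable]: "(\<lambda>x. det (\<chi> i j. if j = k then b x $ i else A x $ i $ j)) \<in> borel_measurable M"
    by (intro borel_measurable_det) simp
  note borel_measurable_det[OF A, measurable]
  have "matrix_inv B = C" if "det B = 0" for B :: "real ^ 'n ^ 'n"
  proof -
    have "\<not> invertible B" using that by (simp add: invertible_det_nz)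
    then have "(\<lambda>B'. B ** B' = mat 1 \<and> B' ** B = mat 1) = (\<lambda>_. False)"
      unfolding invertible_def by blast
    then show ?thesis by (simp add: matrix_inv_def C_def)
  qed
  then have "(matrix_inv (A x) *v b x) $ k = (if det (A x) = 0 then (\<Sum>j\<in>UNIV. C $ k $ j * b x $ j)
     else det (\<chi> i j. if j = k then b x $ i else A x $ i $ j) / det (A x))" for x
    by (cases "det (A x) = 0")
      (simp_all add: matrix_inv_mult_eq_cramer_solution cramer_solution_def, simp add: matrix_vector_mult_def)
  then show "(\<lambda>x. (matrix_inv (A x) *v b x) $ k) \<in> borel_measurable M" by simp
qed

section \<open>The randomized experiment\<close>

locale randomized_experiment = prob_space M for M :: "'a measure" +
  fixes W :: "nat \<Rightarrow> 'a \<Rightarrow> real ^ 'g"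
    and Y :: "nat \<Rightarrow> 'a \<Rightarrow> real ^ 'g"
    and X :: "nat \<Rightarrow> 'a \<Rightarrow> real ^ 'k"
  assumes measW [measurable]: "\<And>i. W i \<in> borel_measurable M"
    and measY [measurable]: "\<And>i. Y i \<in> borel_measurable M"
    and measX [measurable]: "\<And>i. X i \<in> borel_measurable M"
    and W01: "\<And>i \<omega> g. \<omega> \<in> space M \<Longrightarrow> W i \<omega> $ g \<in> {0, 1}"
    and Wsum: "\<And>i \<omega>. \<omega> \<in> space M \<Longrightarrow> (\<Sum>g\<in>UNIV. W i \<omega> $ g) = 1"
    and rho_pos: "\<And>g. rho M W g > 0"
    and indepWYX: "indep_set
                   {W 0 -` A \<inter> space M | A. A \<in> sets borel}
                   {(\<lambda>\<omega>. (Y 0 \<omega>, X 0 \<omega>)) -` B \<inter> space M | B. B \<in> sets borel}"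
    and iid_indep: "indep_vars (\<lambda>_. borel) (\<lambda>i \<omega>. (W i \<omega>, Y i \<omega>, X i \<omega>)) UNIV"
    and iid_ident: "\<And>i. distr M borel (\<lambda>\<omega>. (W i \<omega>, Y i \<omega>, X i \<omega>))
                        = distr M borel (\<lambda>\<omega>. (W 0 \<omega>, Y 0 \<omega>, X 0 \<omega>))"
    and momY: "\<And>g. integrable M (\<lambda>\<omega>. (Y 0 \<omega> $ g)\<^sup>2)"
    and momX: "\<And>k. integrable M (\<lambda>\<omega>. (X 0 \<omega> $ k)\<^sup>2)"
    and SigmaX_inv: "invertible (SigmaX M X)"
begin

abbreviation "\<rho> \<equiv> rho M W"
abbreviation "\<mu> \<equiv> mu M Y"
abbreviation "m \<equiv> meanX M X"
abbreviation "\<beta> \<equiv> beta M Y X"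

sublocale iid_sequence M "\<lambda>i \<omega>. (W i \<omega>, Y i \<omega>, X i \<omega>)"
  by unfold_locales (fact iid_indep, fact iid_ident)

lemma W_mult_W: "\<omega> \<in> space M \<Longrightarrow> W i \<omega> $ g * W i \<omega> $ h = (if g = h then W i \<omega> $ g else 0)"
proof (cases "g = h")
  case False
  assume \<omega>: "\<omega> \<in> space M"
  have "W i \<omega> $ g + W i \<omega> $ h = (\<Sum>a\<in>{g, h}. W i \<omega> $ a)" using False by simp
  also have "\<dots> \<le> (\<Sum>a\<in>UNIV. W i \<omega> $ a)" 
    using W01[OF \<omega>] by (intro sum_mono2) (auto, metis order_refl zero_le_one)
  finally show ?thesis using W01[OF \<omega>, of i g] W01[OF \<omega>, of i h] Wsum[OF \<omega>, of i] False by auto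
qed (use W01[of \<omega> i g] in auto)

lemma W_mult_Yobs: "\<omega> \<in> space M \<Longrightarrow> W i \<omega> $ g * Yobs W Y i \<omega> = W i \<omega> $ g * Y i \<omega> $ g"
proof -
  assume \<omega>: "\<omega> \<in> space M"
  have "W i \<omega> $ g * Yobs W Y i \<omega> = (\<Sum>h\<in>UNIV. (W i \<omega> $ g * W i \<omega> $ h) * Y i \<omega> $ h)"
    by (simp add: Yobs_def sum_distrib_left mult_ac)
  also have "\<dots> = (\<Sum>h\<in>UNIV. if g = h then W i \<omega> $ g * Y i \<omega> $ h else 0)"
    by (intro sum.cong) (auto simp: W_mult_W[OF \<omega>])
  finally show ?thesis by simp
qed

lemma expectation_W: "expectation (\<lambda>\<omega>. W 0 \<omega> $ g) = \<rho> g"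
proof -
  have "expectation (\<lambda>\<omega>. W 0 \<omega> $ g) = expectation (indicator {\<omega>\<in>space M. W 0 \<omega> $ g = 1})"
    using W01[of _ 0 g] by (intro Bochner_Integration.integral_cong) (auto simp: indicator_def)
  then show ?thesis by (simp add: rho_def)
qed

lemma W_integrable: "integrable M (\<lambda>\<omega>. W 0 \<omega> $ g)"
proof (rule integrable_const_bound[where B=1])
  have "norm (W 0 \<omega> $ g) \<le> 1" if "\<omega> \<in> space M" for \<omega>
    using W01[OF that, of 0 g] by auto
  then show "AE \<omega> in M. norm (W 0 \<omega> $ g) \<le> 1" by (rule AE_I2)
qed simp

lemma sum_rho: "(\<Sum>g\<in>UNIV. \<rho> g) = 1"
proof -
  have "(\<Sum>g\<in>UNIV. \<rho> g) = expectation (\<lambda>\<omega>. \<Sum>g\<in>UNIV. W 0 \<omega> $ g)"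
    using W_integrable by (simp add: expectation_W)
  also have "\<dots> = expectation (\<lambda>\<omega>. 1)"
    by (intro Bochner_Integration.integral_cong) (auto simp: Wsum)
  finally show ?thesis by (simp add: prob_space)
qed

lemma indep_W_YX:
  fixes h :: "(real ^ 'g) \<times> (real ^ 'k) \<Rightarrow> real"
  assumes h: "h \<in> borel_measurable borel"
  shows "indep_var borel (\<lambda>\<omega>. W 0 \<omega> $ g) borel (\<lambda>\<omega>. h (Y 0 \<omega>, X 0 \<omega>))"
proof -
  note h [measurable]
  have Int_stable: "Int_stable {Z -` A \<inter> space M |A. A \<in> sets borel}" for Z :: "'a \<Rightarrow> real"
  proof (safe intro!: Int_stableI)
    fix A B :: "real set" assume "A \<in> sets borel" "B \<in> sets borel"
    then show "\<exists>C. (Z -` A \<inter> space M) \<inter> (Z -` B \<inter> space M) = Z -` C \<inter> space M \<and> C \<in> sets borel"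
      by (intro exI[of _ "A \<inter> B"]) auto
  qed
  have Wg: "(\<lambda>w :: real ^ 'g. w $ g) \<in> borel_measurable borel" by simp
  have "indep_set {(\<lambda>\<omega>. W 0 \<omega> $ g) -` A \<inter> space M | A. A \<in> sets borel}
      {(\<lambda>\<omega>. h (Y 0 \<omega>, X 0 \<omega>)) -` B \<inter> space M | B. B \<in> sets borel}"
  proof (rule indep_setI)
    fix a b
    assume "a \<in> {(\<lambda>\<omega>. W 0 \<omega> $ g) -` A \<inter> space M | A. A \<in> sets borel}"
      and "b \<in> {(\<lambda>\<omega>. h (Y 0 \<omega>, X 0 \<omega>)) -` B \<inter> space M | B. B \<in> sets borel}"
    then obtain A B where A: "A \<in> sets borel" "a = W 0 -` ((\<lambda>w. w $ g) -` A) \<inter> space M"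
      and B: "B \<in> sets borel" "b = (\<lambda>\<omega>. (Y 0 \<omega>, X 0 \<omega>)) -` (h -` B) \<inter> space M"
      by (auto simp: vimage_def)
    have "(\<lambda>w :: real ^ 'g. w $ g) -` A \<in> sets borel" "h -` B \<in> sets borel"
      using measurable_sets[OF Wg A(1)] measurable_sets[OF h B(1)] by simp_all
    with A(2) B(2) show "prob (a \<inter> b) = prob a * prob b"
      by (intro indep_setD[OF indepWYX]) blast+
  qed (auto intro!: measurable_sets[of _ M borel])
  then show ?thesis
    unfolding indep_var_eq by (intro conjI indep_set_sigma_sets Int_stable) auto
qed

lemma W_mult_YX:
  fixes h :: "(real ^ 'g) \<times> (real ^ 'k) \<Rightarrow> real"
  assumes [measurable]: "h \<in> borel_measurable borel" and int: "integrable M (\<lambda>\<omega>. h (Y 0 \<omega>, X 0 \<omega>))"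
  shows "integrable M (\<lambda>\<omega>. W 0 \<omega> $ g * h (Y 0 \<omega>, X 0 \<omega>))"
    and "expectation (\<lambda>\<omega>. W 0 \<omega> $ g * h (Y 0 \<omega>, X 0 \<omega>)) = \<rho> g * expectation (\<lambda>\<omega>. h (Y 0 \<omega>, X 0 \<omega>))"
proof -
  have "indep_var borel (\<lambda>\<omega>. W 0 \<omega> $ g) borel (\<lambda>\<omega>. h (Y 0 \<omega>, X 0 \<omega>))"
    by (rule indep_W_YX) fact
  then show "integrable M (\<lambda>\<omega>. W 0 \<omega> $ g * h (Y 0 \<omega>, X 0 \<omega>))"
    and "expectation (\<lambda>\<omega>. W 0 \<omega> $ g * h (Y 0 \<omega>, X 0 \<omega>)) = \<rho> g * expectation (\<lambda>\<omega>. h (Y 0 \<omega>, X 0 \<omega>))"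
    using indep_var_integrable[OF _ W_integrable int] indep_var_lebesgue_integral[OF _ W_integrable int]
    by (simp_all add: expectation_W)
qed

lemma WW_mult_YX:
  fixes h :: "(real ^ 'g) \<times> (real ^ 'k) \<Rightarrow> real"
  assumes "h \<in> borel_measurable borel" and "integrable M (\<lambda>\<omega>. h (Y 0 \<omega>, X 0 \<omega>))"
  shows "integrable M (\<lambda>\<omega>. W 0 \<omega> $ g * W 0 \<omega> $ g' * h (Y 0 \<omega>, X 0 \<omega>))"
    and "expectation (\<lambda>\<omega>. W 0 \<omega> $ g * W 0 \<omega> $ g' * h (Y 0 \<omega>, X 0 \<omega>))
      = (if g = g' then \<rho> g * expectation (\<lambda>\<omega>. h (Y 0 \<omega>, X 0 \<omega>)) else 0)"
proof -
  have eq: "W 0 \<omega> $ g * W 0 \<omega> $ g' * h (Y 0 \<omega>, X 0 \<omega>) = (if g = g' then W 0 \<omega> $ g * h (Y 0 \<omega>, X 0 \<omega>) else 0)"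
    if "\<omega> \<in> space M" for \<omega>
    using W_mult_W[OF that, of 0 g g'] by simp
  let ?f = "\<lambda>\<omega>. W 0 \<omega> $ g * W 0 \<omega> $ g' * h (Y 0 \<omega>, X 0 \<omega>)"
  let ?f' = "\<lambda>\<omega>. if g = g' then W 0 \<omega> $ g * h (Y 0 \<omega>, X 0 \<omega>) else 0"
  have "integrable M ?f \<longleftrightarrow> integrable M ?f'"
    by (intro Bochner_Integration.integrable_cong refl eq)
  then show "integrable M ?f"
    using W_mult_YX(1)[OF assms, of g] by (cases "g = g'") simp_all
  have "expectation ?f = expectation ?f'"
    by (intro Bochner_Integration.integral_cong refl eq)
  then show "expectation ?f = (if g = g' then \<rho> g * expectation (\<lambda>\<omega>. h (Y 0 \<omega>, X 0 \<omega>)) else 0)"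
    using W_mult_YX(2)[OF assms, of g] by (cases "g = g'") simp_all
qed

definition dY :: "'g \<Rightarrow> (real ^ 'g) \<times> (real ^ 'k) \<Rightarrow> real" where
  "dY g = (\<lambda>(y, x). y $ g - \<mu> $ g)"

definition dX :: "'k \<Rightarrow> (real ^ 'g) \<times> (real ^ 'k) \<Rightarrow> real" where
  "dX j = (\<lambda>(y, x). x $ j - m $ j)"

lemma dY_measurable [measurable]: "dY g \<in> borel_measurable borel"
  unfolding dY_def case_prod_unfold by (intro borel_measurable_continuous_onI continuous_intros)

lemma dX_measurable [measurable]: "dX j \<in> borel_measurable borel"
  unfolding dX_def case_prod_unfold by (intro borel_measurable_continuous_onI continuous_intros)

abbreviation YX :: "nat \<Rightarrow> 'a \<Rightarrow> (real ^ 'g) \<times> (real ^ 'k)" where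
  "YX i \<omega> \<equiv> (Y i \<omega>, X i \<omega>)"

lemma Y_integrable: "integrable M (\<lambda>\<omega>. Y 0 \<omega> $ g)"
  by (rule square_integrable_imp_integrable[OF _ momY]) simp

lemma X_integrable: "integrable M (\<lambda>\<omega>. X 0 \<omega> $ j)"
  by (rule square_integrable_imp_integrable[OF _ momX]) simp

lemma dY_square_integrable: "integrable M (\<lambda>\<omega>. (dY g (YX 0 \<omega>))\<^sup>2)"
  using momY[of g] Y_integrable[of g] by (simp add: dY_def power2_diff)

lemma dX_square_integrable: "integrable M (\<lambda>\<omega>. (dX j (YX 0 \<omega>))\<^sup>2)"
  using momX[of j] X_integrable[of j] by (simp add: dX_def power2_diff)

lemma dY_mean: "expectation (\<lambda>\<omega>. dY g (YX 0 \<omega>)) = 0"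
  using Y_integrable[of g] by (simp add: dY_def mu_def prob_space)

lemma dX_mean: "expectation (\<lambda>\<omega>. dX j (YX 0 \<omega>)) = 0"
  using X_integrable[of j] by (simp add: dX_def meanX_def prob_space)

lemmas dY_integrable = square_integrable_imp_integrable[OF _ dY_square_integrable, simplified]
lemmas dX_integrable = square_integrable_imp_integrable[OF _ dX_square_integrable, simplified]

lemma dX_dX_integrable: "integrable M (\<lambda>\<omega>. dX j (YX 0 \<omega>) * dX l (YX 0 \<omega>))"
  by (intro integrable_mult_square_integrable dX_square_integrable) auto

lemma dX_dY_integrable: "integrable M (\<lambda>\<omega>. dX j (YX 0 \<omega>) * dY g (YX 0 \<omega>))"
  by (intro integrable_mult_square_integrable dX_square_integrable dY_square_integrable) auto

lemma dX_dX_expectation: "expectation (\<lambda>\<omega>. dX j (YX 0 \<omega>) * dX l (YX 0 \<omega>)) = SigmaX M X $ j $ l"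
  by (simp add: SigmaX_def Xdot_def dX_def)

lemma SigmaX_beta: "SigmaX M X *v \<beta> g = (\<chi> j. expectation (\<lambda>\<omega>. dX j (YX 0 \<omega>) * dY g (YX 0 \<omega>)))"
  using matrix_inv_right_inverse[OF SigmaX_inv]
  by (simp add: beta_def matrix_vector_mul_assoc Xdot_def dX_def dY_def)

lemma borel_measurable_prod_mult:
  fixes f :: "'c::topological_space \<Rightarrow> real" and h :: "'d::topological_space \<Rightarrow> real"
  assumes f: "f \<in> borel_measurable borel" and h: "h \<in> borel_measurable borel"
  shows "(\<lambda>p. f (fst p) * h (snd p)) \<in> borel_measurable borel"
  by (intro borel_measurable_times measurable_compose[OF _ f] measurable_compose[OF _ h]
      borel_measurable_continuous_onI continuous_intros)

lemma tendsto_average: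
  fixes h :: "(real ^ 'g) \<times> (real ^ 'k) \<Rightarrow> real"
  assumes [measurable]: "h \<in> borel_measurable borel" and int: "integrable M (\<lambda>\<omega>. h (YX 0 \<omega>))"
  shows "((\<lambda>(n, \<omega>). (\<Sum>i<n. W i \<omega> $ g * h (YX i \<omega>)) / real n)
    \<longlongrightarrow> \<rho> g * expectation (\<lambda>\<omega>. h (YX 0 \<omega>))) (whp M)"
  using weak_law_of_large_numbers[of "\<lambda>(w, yx). w $ g * h yx"] W_mult_YX[OF assms, of g]
    borel_measurable_prod_mult[of "\<lambda>w. w $ g" h]
  by (simp add: case_prod_unfold)

lemma bounded_in_prob_W:
  fixes h :: "(real ^ 'g) \<times> (real ^ 'k) \<Rightarrow> real"
  assumes [measurable]: "h \<in> borel_measurable borel" and sq: "integrable M (\<lambda>\<omega>. (h (YX 0 \<omega>))\<^sup>2)"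
    and mean: "expectation (\<lambda>\<omega>. h (YX 0 \<omega>)) = 0"
  shows "bounded_in_prob M (\<lambda>n \<omega>. (\<Sum>i<n. W i \<omega> $ g * h (YX i \<omega>)) / sqrt (real n))"
    and "bounded_in_prob M (\<lambda>n \<omega>. (\<Sum>i<n. h (YX i \<omega>)) / sqrt (real n))"
proof -
  have int: "integrable M (\<lambda>\<omega>. h (YX 0 \<omega>))"
    by (rule square_integrable_imp_integrable[OF _ sq]) simp
  show "bounded_in_prob M (\<lambda>n \<omega>. (\<Sum>i<n. W i \<omega> $ g * h (YX i \<omega>)) / sqrt (real n))"
    using bounded_in_prob_normalized_sum[of "\<lambda>(w, yx). w $ g * h yx"]
      WW_mult_YX(1)[OF _ sq, of g g] W_mult_YX(2)[OF _ int, of g] mean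
      borel_measurable_prod_mult[of "\<lambda>w. w $ g" h]
    by (simp add: case_prod_unfold power2_eq_square mult_ac)
  show "bounded_in_prob M (\<lambda>n \<omega>. (\<Sum>i<n. h (YX i \<omega>)) / sqrt (real n))"
    using bounded_in_prob_normalized_sum[of "\<lambda>(w, yx). h yx"] sq mean
      borel_measurable_prod_mult[of "\<lambda>_ :: real ^ 'g. 1" h]
    by (simp add: case_prod_unfold)
qed

lemma Ng_tendsto: "((\<lambda>(n, \<omega>). Ng W n g \<omega> / real n) \<longlongrightarrow> \<rho> g) (whp M)"
proof -
  have "expectation (\<lambda>\<omega>. 1) = (1 :: real)" by (simp add: prob_space)
  with tendsto_average[OF borel_measurable_const integrable_const, of g 1]
  show ?thesis by (simp only: mult_1_right Ng_def)
qed

lemma eventually_Ng: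
  "eventually (\<lambda>(n, \<omega>). \<omega> \<in> space M \<and> n > 0 \<and> Ng W n g \<omega> \<noteq> 0) (whp M)"
proof -
  have "eventually (\<lambda>(n, \<omega>). \<omega> \<in> space M \<and> n > 0) (whp M)"
    by (rule eventually_whp_surely, rule eventually_mono[OF eventually_gt_at_top[of 0]]) simp
  moreover have "eventually (\<lambda>(n, \<omega>). Ng W n g \<omega> / real n > 0) (whp M)"
    using order_tendstoD(1)[OF Ng_tendsto rho_pos] by (simp add: case_prod_unfold)
  ultimately show ?thesis by eventually_elim auto
qed

lemma Ybar_error:
  assumes "\<omega> \<in> space M" "Ng W n g \<omega> \<noteq> 0"
  shows "Ybar W Y n g \<omega> - \<mu> $ g = (\<Sum>i<n. W i \<omega> $ g * dY g (YX i \<omega>)) / Ng W n g \<omega>"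
proof -
  have "(\<Sum>i<n. W i \<omega> $ g * dY g (YX i \<omega>)) = (\<Sum>i<n. W i \<omega> $ g * Yobs W Y i \<omega>) - \<mu> $ g * Ng W n g \<omega>"
  proof -
    have "W i \<omega> $ g * dY g (YX i \<omega>) = W i \<omega> $ g * Yobs W Y i \<omega> - \<mu> $ g * W i \<omega> $ g" for i
      by (simp add: W_mult_Yobs[OF assms(1)] dY_def right_diff_distrib)
    then show ?thesis by (simp add: Ng_def sum_subtractf sum_distrib_left)
  qed
  then show ?thesis using assms(2) by (simp add: Ybar_def field_simps)
qed

lemma Xbar_g_error:
  assumes "Ng W n g \<omega> \<noteq> 0"
  shows "Xbar_g W X n g \<omega> $ j - m $ j = (\<Sum>i<n. W i \<omega> $ g * dX j (YX i \<omega>)) / Ng W n g \<omega>"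
proof -
  have "(\<Sum>i<n. W i \<omega> $ g * dX j (YX i \<omega>)) = (\<Sum>i<n. W i \<omega> $ g * X i \<omega> $ j) - m $ j * Ng W n g \<omega>"
    by (simp add: dX_def Ng_def algebra_simps sum_subtractf sum_distrib_left)
  then show ?thesis using assms by (simp add: Xbar_g_def field_simps)
qed

lemma Xbar_error:
  assumes "n > 0"
  shows "Xbar X n \<omega> $ j - m $ j = (\<Sum>i<n. dX j (YX i \<omega>)) / real n"
  using assms by (simp add: Xbar_def dX_def sum_subtractf field_simps)

lemma Ybar_tendsto: "((\<lambda>(n, \<omega>). Ybar W Y n g \<omega> - \<mu> $ g) \<longlongrightarrow> 0) (whp M)"
proof (rule Lim_transform_eventually)
  have "((\<lambda>(n, \<omega>). ((\<Sum>i<n. W i \<omega> $ g * dY g (YX i \<omega>)) / real n) / (Ng W n g \<omega> / real n))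
      \<longlongrightarrow> (\<rho> g * expectation (\<lambda>\<omega>. dY g (YX 0 \<omega>))) / \<rho> g) (whp M)"
    using rho_pos[of g] unfolding case_prod_unfold
    by (intro tendsto_divide Ng_tendsto[unfolded case_prod_unfold]
        tendsto_average[OF dY_measurable dY_integrable, unfolded case_prod_unfold]) simp
  then show "((\<lambda>(n, \<omega>). ((\<Sum>i<n. W i \<omega> $ g * dY g (YX i \<omega>)) / real n) / (Ng W n g \<omega> / real n))
      \<longlongrightarrow> 0) (whp M)" by (simp add: dY_mean)
  show "\<forall>\<^sub>F x in whp M. (case x of (n, \<omega>) \<Rightarrow> ((\<Sum>i<n. W i \<omega> $ g * dY g (YX i \<omega>)) / real n) / (Ng W n g \<omega> / real n))
      = (case x of (n, \<omega>) \<Rightarrow> Ybar W Y n g \<omega> - \<mu> $ g)"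
    using eventually_Ng[of g] by eventually_elim (auto simp: Ybar_error)
qed

lemma Xbar_g_tendsto: "((\<lambda>(n, \<omega>). Xbar_g W X n g \<omega> $ j - m $ j) \<longlongrightarrow> 0) (whp M)"
proof (rule Lim_transform_eventually)
  have "((\<lambda>(n, \<omega>). ((\<Sum>i<n. W i \<omega> $ g * dX j (YX i \<omega>)) / real n) / (Ng W n g \<omega> / real n))
      \<longlongrightarrow> (\<rho> g * expectation (\<lambda>\<omega>. dX j (YX 0 \<omega>))) / \<rho> g) (whp M)"
    using rho_pos[of g] unfolding case_prod_unfold
    by (intro tendsto_divide Ng_tendsto[unfolded case_prod_unfold]
        tendsto_average[OF dX_measurable dX_integrable, unfolded case_prod_unfold]) simp
  then show "((\<lambda>(n, \<omega>). ((\<Sum>i<n. W i \<omega> $ g * dX j (YX i \<omega>)) / real n) / (Ng W n g \<omega> / real n))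
      \<longlongrightarrow> 0) (whp M)" by (simp add: dX_mean)
  show "\<forall>\<^sub>F x in whp M. (case x of (n, \<omega>) \<Rightarrow> ((\<Sum>i<n. W i \<omega> $ g * dX j (YX i \<omega>)) / real n) / (Ng W n g \<omega> / real n))
      = (case x of (n, \<omega>) \<Rightarrow> Xbar_g W X n g \<omega> $ j - m $ j)"
    using eventually_Ng[of g] by eventually_elim (auto simp: Xbar_g_error)
qed

lemma centered_product_tendsto:
  fixes p q :: "(real ^ 'g) \<times> (real ^ 'k) \<Rightarrow> real" and d e :: "nat \<Rightarrow> 'a \<Rightarrow> real"
  assumes p: "p \<in> borel_measurable borel" "integrable M (\<lambda>\<omega>. p (YX 0 \<omega>))"
    and q: "q \<in> borel_measurable borel" "integrable M (\<lambda>\<omega>. q (YX 0 \<omega>))"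
    and pq: "integrable M (\<lambda>\<omega>. p (YX 0 \<omega>) * q (YX 0 \<omega>))"
    and d: "((\<lambda>(n, \<omega>). d n \<omega>) \<longlongrightarrow> 0) (whp M)" and e: "((\<lambda>(n, \<omega>). e n \<omega>) \<longlongrightarrow> 0) (whp M)"
  shows "((\<lambda>(n, \<omega>). (\<Sum>i<n. W i \<omega> $ g * (p (YX i \<omega>) - d n \<omega>) * (q (YX i \<omega>) - e n \<omega>)) / real n)
    \<longlongrightarrow> \<rho> g * expectation (\<lambda>\<omega>. p (YX 0 \<omega>) * q (YX 0 \<omega>))) (whp M)"
proof -
  have eq: "(\<Sum>i<n. W i \<omega> $ g * (p (YX i \<omega>) - d n \<omega>) * (q (YX i \<omega>) - e n \<omega>)) / real n
    = (\<Sum>i<n. W i \<omega> $ g * (p (YX i \<omega>) * q (YX i \<omega>))) / real n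
      - d n \<omega> * ((\<Sum>i<n. W i \<omega> $ g * q (YX i \<omega>)) / real n)
      - e n \<omega> * ((\<Sum>i<n. W i \<omega> $ g * p (YX i \<omega>)) / real n)
      + d n \<omega> * e n \<omega> * (Ng W n g \<omega> / real n)" for n \<omega>
    by (simp add: Ng_def algebra_simps sum.distrib sum_subtractf sum_distrib_left sum_divide_distrib
        add_divide_distrib diff_divide_distrib)
  have pqm: "(\<lambda>z. p z * q z) \<in> borel_measurable borel" using p q by simp
  have "((\<lambda>(n, \<omega>). (\<Sum>i<n. W i \<omega> $ g * (p (YX i \<omega>) - d n \<omega>) * (q (YX i \<omega>) - e n \<omega>)) / real n)
    \<longlongrightarrow> \<rho> g * expectation (\<lambda>\<omega>. p (YX 0 \<omega>) * q (YX 0 \<omega>))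
      - 0 * (\<rho> g * expectation (\<lambda>\<omega>. q (YX 0 \<omega>)))
      - 0 * (\<rho> g * expectation (\<lambda>\<omega>. p (YX 0 \<omega>)))
      + 0 * 0 * \<rho> g) (whp M)"
    using tendsto_average[OF pqm pq, of g] tendsto_average[OF p, of g] tendsto_average[OF q, of g]
      Ng_tendsto[of g] d e
    unfolding eq case_prod_unfold by (intro tendsto_intros)
  then show ?thesis by simp
qed

lemma beta_hat_tendsto: "((\<lambda>(n, \<omega>). beta_hat W Y X n g \<omega>) \<longlongrightarrow> \<beta> g) (whp M)"
proof -
  let ?A = "\<lambda>n \<omega>. \<chi> j l. (\<Sum>i<n. W i \<omega> $ g * (dX j (YX i \<omega>) - (Xbar_g W X n g \<omega> $ j - m $ j))
      * (dX l (YX i \<omega>) - (Xbar_g W X n g \<omega> $ l - m $ l))) / real n"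
  let ?b = "\<lambda>n \<omega>. \<chi> j. (\<Sum>i<n. W i \<omega> $ g * (dX j (YX i \<omega>) - (Xbar_g W X n g \<omega> $ j - m $ j))
      * (dY g (YX i \<omega>) - (Ybar W Y n g \<omega> - \<mu> $ g))) / real n"
  let ?c = "\<chi> j. expectation (\<lambda>\<omega>. dX j (YX 0 \<omega>) * dY g (YX 0 \<omega>))"
  have A: "((\<lambda>x. ?A (fst x) (snd x)) \<longlongrightarrow> \<rho> g *\<^sub>R SigmaX M X) (whp M)"
    using centered_product_tendsto[OF dX_measurable dX_integrable dX_measurable dX_integrable
        dX_dX_integrable Xbar_g_tendsto Xbar_g_tendsto]
    by (intro vec_tendstoI) (simp add: case_prod_unfold dX_dX_expectation)
  have b: "((\<lambda>x. ?b (fst x) (snd x)) \<longlongrightarrow> \<rho> g *\<^sub>R ?c) (whp M)"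
    using centered_product_tendsto[OF dX_measurable dX_integrable dY_measurable dY_integrable
        dX_dY_integrable Xbar_g_tendsto Ybar_tendsto]
    by (intro vec_tendstoI) (simp add: case_prod_unfold)
  have det0: "det (\<rho> g *\<^sub>R SigmaX M X) \<noteq> 0"
  proof -
    have "\<rho> g *\<^sub>R SigmaX M X = (\<chi> i. \<rho> g *s (SigmaX M X $ i))" by (simp add: vec_eq_iff)
    then show ?thesis using SigmaX_inv rho_pos[of g] by (simp add: det_rows_mul invertible_det_nz)
  qed
  have "(\<rho> g *\<^sub>R SigmaX M X) *v \<beta> g = \<rho> g *\<^sub>R ?c"
    by (simp add: SigmaX_beta flip: scaleR_matrix_vector_assoc)
  then have lim: "cramer_solution (\<rho> g *\<^sub>R SigmaX M X) (\<rho> g *\<^sub>R ?c) = \<beta> g"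
    using cramer[OF det0] unfolding cramer_solution_def by metis
  have "((\<lambda>x. cramer_solution (?A (fst x) (snd x)) (?b (fst x) (snd x))) \<longlongrightarrow> \<beta> g) (whp M)"
    using tendsto_cramer_solution[OF A b det0] unfolding lim .
  moreover have "\<forall>\<^sub>F x in whp M. cramer_solution (?A (fst x) (snd x)) (?b (fst x) (snd x))
      = (case x of (n, \<omega>) \<Rightarrow> beta_hat W Y X n g \<omega>)"
    using eventually_Ng[of g] tendsto_imp_eventually_ne[OF tendsto_det[OF A] det0]
  proof eventually_elim
    case (elim x)
    obtain n \<omega> where x: "x = (n, \<omega>)" by (cases x)
    have *: "\<omega> \<in> space M" "n > 0" "det (?A n \<omega>) \<noteq> 0" using elim by (auto simp: x)
    have "W i \<omega> $ g * (dX j (YX i \<omega>) - (Xbar_g W X n g \<omega> $ j - m $ j))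
        * (dY g (YX i \<omega>) - (Ybar W Y n g \<omega> - \<mu> $ g))
      = W i \<omega> $ g * (X i \<omega> - Xbar_g W X n g \<omega>) $ j * (Yobs W Y i \<omega> - Ybar W Y n g \<omega>)" for i j
    proof -
      have "W i \<omega> $ g * (dY g (YX i \<omega>) - (Ybar W Y n g \<omega> - \<mu> $ g)) = W i \<omega> $ g * (Yobs W Y i \<omega> - Ybar W Y n g \<omega>)"
        using W_mult_Yobs[OF *(1), of i g] by (auto simp: dY_def right_diff_distrib)
      moreover have "dX j (YX i \<omega>) - (Xbar_g W X n g \<omega> $ j - m $ j) = (X i \<omega> - Xbar_g W X n g \<omega>) $ j"
        by (simp add: dX_def)
      moreover have "w * p * q = p * (w * q)" for w p q :: real by simp
      ultimately show ?thesis by (simp only:)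
    qed
    then have "?b n \<omega> = (\<chi> j. (\<Sum>i<n. W i \<omega> $ g * (X i \<omega> - Xbar_g W X n g \<omega>) $ j
                                 * (Yobs W Y i \<omega> - Ybar W Y n g \<omega>)) / real n)"
      by (simp only:)
    moreover have "?A n \<omega> = (\<chi> j l. (\<Sum>i<n. W i \<omega> $ g * (X i \<omega> - Xbar_g W X n g \<omega>) $ j
                                         * (X i \<omega> - Xbar_g W X n g \<omega>) $ l) / real n)"
      by (simp add: dX_def)
    moreover have "real n *\<^sub>R (\<chi> j. v j / real n) = (\<chi> j. v j)" for v :: "'k \<Rightarrow> real"
      using *(2) by (simp add: vec_eq_iff)
    moreover have "real n *\<^sub>R (\<chi> j l. v j l / real n) = (\<chi> j l. v j l)" for v :: "'k \<Rightarrow> 'k \<Rightarrow> real"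
      using *(2) by (simp add: vec_eq_iff)
    ultimately have "beta_hat W Y X n g \<omega> = matrix_inv (real n *\<^sub>R ?A n \<omega>) *v (real n *\<^sub>R ?b n \<omega>)"
      by (simp only: beta_hat_def)
    also have "\<dots> = cramer_solution (?A n \<omega>) (?b n \<omega>)"
      using * by (intro matrix_inv_scaleR_mult_scaleR) auto
    finally show ?case by (simp add: x)
  qed
  ultimately show ?thesis by (rule Lim_transform_eventually)
qed

definition xi_SM :: "(real ^ 'g) \<times> (real ^ 'g) \<times> (real ^ 'k) \<Rightarrow> real ^ 'g" where
  "xi_SM = (\<lambda>(w, yx). \<chi> g. w $ g * dY g yx / \<rho> g)"

definition xi_SRA :: "(real ^ 'g) \<times> (real ^ 'g) \<times> (real ^ 'k) \<Rightarrow> real ^ 'g" where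
  "xi_SRA = (\<lambda>(w, yx). \<chi> g. w $ g * dY g yx / \<rho> g + (\<Sum>j\<in>UNIV. (dX j yx - w $ g * dX j yx / \<rho> g) * \<beta> g $ j))"

lemma xi_SM_measurable [measurable]: "xi_SM \<in> borel_measurable borel"
  unfolding xi_SM_def dY_def case_prod_unfold
  by (intro borel_measurable_continuous_onI continuous_intros) (use rho_pos in \<open>auto simp: less_le\<close>)

lemma xi_SRA_measurable [measurable]: "xi_SRA \<in> borel_measurable borel"
  unfolding xi_SRA_def dY_def dX_def case_prod_unfold
  by (intro borel_measurable_continuous_onI continuous_intros) (use rho_pos in \<open>auto simp: less_le\<close>)

lemma Ybar_measurable [measurable]: "Ybar W Y n g \<in> borel_measurable M"
  unfolding Ybar_def Yobs_def Ng_def by measurable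

lemma Xbar_g_measurable [measurable]: "Xbar_g W X n g \<in> borel_measurable M"
  unfolding Xbar_g_def Ng_def by measurable

lemma beta_hat_measurable [measurable]: "beta_hat W Y X n g \<in> borel_measurable M"
  unfolding beta_hat_def Yobs_def
  by (rule borel_measurable_matrix_inv_mult) simp_all

lemma mu_SM_measurable [measurable]: "mu_SM W Y n \<in> borel_measurable M"
  by (rule borel_measurable_vecI) (simp add: mu_SM_def)

lemma mu_SRA_measurable [measurable]: "mu_SRA W Y X n \<in> borel_measurable M"
  by (rule borel_measurable_vecI) (simp add: mu_SRA_def alpha_hat_def Xbar_def)

lemma inverse_Ng_tendsto: "((\<lambda>(n, \<omega>). 1 / (Ng W n g \<omega> / real n) - 1 / \<rho> g) \<longlongrightarrow> 0) (whp M)"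
proof -
  have "((\<lambda>(n, \<omega>). 1 / (Ng W n g \<omega> / real n) - 1 / \<rho> g) \<longlongrightarrow> 1 / \<rho> g - 1 / \<rho> g) (whp M)"
    using Ng_tendsto[of g] rho_pos[of g] unfolding case_prod_unfold by (intro tendsto_intros) auto
  then show ?thesis by simp
qed

lemma sqrt_mult_divide_Ng:
  "n > 0 \<Longrightarrow> sqrt (real n) * (s / Ng W n g \<omega>) = 1 / (Ng W n g \<omega> / real n) * (s / sqrt (real n))"
  by (subst real_div_sqrt[symmetric]) simp_all

lemma SM_asymptotically_linear:
  "((\<lambda>(n, \<omega>). (sqrt (real n) *\<^sub>R (mu_SM W Y n \<omega> - \<mu>)) $ g
    - (\<Sum>i<n. xi_SM (W i \<omega>, YX i \<omega>) $ g) / sqrt (real n)) \<longlongrightarrow> 0) (whp M)"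
proof (rule Lim_transform_eventually)
  show "((\<lambda>(n, \<omega>). (1 / (Ng W n g \<omega> / real n) - 1 / \<rho> g)
      * ((\<Sum>i<n. W i \<omega> $ g * dY g (YX i \<omega>)) / sqrt (real n))) \<longlongrightarrow> 0) (whp M)"
    by (rule tendsto_null_mult_bounded_in_prob[OF inverse_Ng_tendsto
          bounded_in_prob_W(1)[OF dY_measurable dY_square_integrable dY_mean]])
  show "\<forall>\<^sub>F x in whp M. (case x of (n, \<omega>) \<Rightarrow> (1 / (Ng W n g \<omega> / real n) - 1 / \<rho> g)
      * ((\<Sum>i<n. W i \<omega> $ g * dY g (YX i \<omega>)) / sqrt (real n)))
     = (case x of (n, \<omega>) \<Rightarrow> (sqrt (real n) *\<^sub>R (mu_SM W Y n \<omega> - \<mu>)) $ g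
    - (\<Sum>i<n. xi_SM (W i \<omega>, YX i \<omega>) $ g) / sqrt (real n))"
    using eventually_Ng[of g]
  proof eventually_elim
    case (elim x)
    obtain n \<omega> where x: "x = (n, \<omega>)" by (cases x)
    have *: "\<omega> \<in> space M" "n > 0" "Ng W n g \<omega> \<noteq> 0" using elim by (auto simp: x)
    have "(sqrt (real n) *\<^sub>R (mu_SM W Y n \<omega> - \<mu>)) $ g
      = 1 / (Ng W n g \<omega> / real n) * ((\<Sum>i<n. W i \<omega> $ g * dY g (YX i \<omega>)) / sqrt (real n))"
      using * by (simp add: mu_SM_def Ybar_error sqrt_mult_divide_Ng del: times_divide_eq_left times_divide_eq_right divide_divide_eq_right)
    moreover have "(\<Sum>i<n. xi_SM (W i \<omega>, YX i \<omega>) $ g) / sqrt (real n)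
      = 1 / \<rho> g * ((\<Sum>i<n. W i \<omega> $ g * dY g (YX i \<omega>)) / sqrt (real n))"
      by (simp add: xi_SM_def mult.commute flip: sum_divide_distrib)
    ultimately show ?case unfolding x prod.case left_diff_distrib by simp
  qed
qed

lemma SRA_asymptotically_linear:
  "((\<lambda>(n, \<omega>). (sqrt (real n) *\<^sub>R (mu_SRA W Y X n \<omega> - \<mu>)) $ g
    - (\<Sum>i<n. xi_SRA (W i \<omega>, YX i \<omega>) $ g) / sqrt (real n)) \<longlongrightarrow> 0) (whp M)"
proof (rule Lim_transform_eventually)
  let ?a = "\<lambda>n \<omega>. 1 / (Ng W n g \<omega> / real n)"
  let ?SY = "\<lambda>n \<omega>. (\<Sum>i<n. W i \<omega> $ g * dY g (YX i \<omega>)) / sqrt (real n)"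
  let ?SX = "\<lambda>j n \<omega>. (\<Sum>i<n. dX j (YX i \<omega>)) / sqrt (real n)"
  let ?SWX = "\<lambda>j n \<omega>. (\<Sum>i<n. W i \<omega> $ g * dX j (YX i \<omega>)) / sqrt (real n)"
  let ?R = "\<lambda>(n, \<omega>). (?a n \<omega> - 1 / \<rho> g) * ?SY n \<omega> +
     (\<Sum>j\<in>UNIV. (beta_hat W Y X n g \<omega> $ j - \<beta> g $ j) * ?SX j n \<omega>
        - (?a n \<omega> * beta_hat W Y X n g \<omega> $ j - 1 / \<rho> g * \<beta> g $ j) * ?SWX j n \<omega>)"
  have b: "((\<lambda>(n, \<omega>). beta_hat W Y X n g \<omega> $ j - \<beta> g $ j) \<longlongrightarrow> 0) (whp M)" for j
  proof -
    have "((\<lambda>(n, \<omega>). beta_hat W Y X n g \<omega> $ j - \<beta> g $ j) \<longlongrightarrow> \<beta> g $ j - \<beta> g $ j) (whp M)"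
      using beta_hat_tendsto[of g] unfolding case_prod_unfold by (intro tendsto_intros)
    then show ?thesis by simp
  qed
  have ab: "((\<lambda>(n, \<omega>). ?a n \<omega> * beta_hat W Y X n g \<omega> $ j - 1 / \<rho> g * \<beta> g $ j) \<longlongrightarrow> 0) (whp M)" for j
  proof -
    have "((\<lambda>(n, \<omega>). ?a n \<omega> * beta_hat W Y X n g \<omega> $ j - 1 / \<rho> g * \<beta> g $ j)
        \<longlongrightarrow> 1 / \<rho> g * \<beta> g $ j - 1 / \<rho> g * \<beta> g $ j) (whp M)"
      using beta_hat_tendsto[of g] Ng_tendsto[of g] rho_pos[of g]
      unfolding case_prod_unfold by (intro tendsto_intros) auto
    then show ?thesis by simp
  qed
  have bX: "bounded_in_prob M (?SX j)" "bounded_in_prob M (?SWX j)" for j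
    by (rule bounded_in_prob_W[OF dX_measurable dX_square_integrable dX_mean])+
  have "(?R \<longlongrightarrow> 0 + (\<Sum>j\<in>(UNIV :: 'k set). 0 - 0)) (whp M)"
    using tendsto_null_mult_bounded_in_prob[OF inverse_Ng_tendsto
        bounded_in_prob_W(1)[OF dY_measurable dY_square_integrable dY_mean], of g g]
      tendsto_null_mult_bounded_in_prob[OF b bX(1)] tendsto_null_mult_bounded_in_prob[OF ab bX(2)]
    unfolding case_prod_unfold by (intro tendsto_add tendsto_sum tendsto_diff)
  then show "(?R \<longlongrightarrow> 0) (whp M)" by simp
  show "\<forall>\<^sub>F x in whp M. ?R x
     = (case x of (n, \<omega>) \<Rightarrow> (sqrt (real n) *\<^sub>R (mu_SRA W Y X n \<omega> - \<mu>)) $ g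
    - (\<Sum>i<n. xi_SRA (W i \<omega>, YX i \<omega>) $ g) / sqrt (real n))"
    using eventually_Ng[of g]
  proof eventually_elim
    case (elim x)
    obtain n \<omega> where x: "x = (n, \<omega>)" by (cases x)
    have *: "\<omega> \<in> space M" "n > 0" "Ng W n g \<omega> \<noteq> 0" using elim by (auto simp: x)
    let ?B = "beta_hat W Y X n g \<omega>"
    have Y': "sqrt (real n) * (Ybar W Y n g \<omega> - \<mu> $ g) = ?a n \<omega> * ?SY n \<omega>"
      unfolding Ybar_error[OF *(1,3)] using *(2) by (rule sqrt_mult_divide_Ng)
    have WX: "sqrt (real n) * (Xbar_g W X n g \<omega> $ j - m $ j) = ?a n \<omega> * ?SWX j n \<omega>" for j
      unfolding Xbar_g_error[OF *(3)] using *(2) by (rule sqrt_mult_divide_Ng)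
    have X': "sqrt (real n) * (Xbar X n \<omega> $ j - m $ j) = ?SX j n \<omega>" for j
      unfolding Xbar_error[OF *(2)] using *(2) by (subst real_div_sqrt[symmetric]) simp_all
    have "(sqrt (real n) *\<^sub>R (mu_SRA W Y X n \<omega> - \<mu>)) $ g = sqrt (real n) * (Ybar W Y n g \<omega> - \<mu> $ g)
       + (\<Sum>j\<in>UNIV. (sqrt (real n) * (Xbar X n \<omega> $ j - m $ j)
          - sqrt (real n) * (Xbar_g W X n g \<omega> $ j - m $ j)) * ?B $ j)"
      by (simp add: mu_SRA_def alpha_hat_def inner_vec_def algebra_simps sum_subtractf sum.distrib sum_distrib_left)
    also have "\<dots> = ?a n \<omega> * ?SY n \<omega> + (\<Sum>j\<in>UNIV. (?SX j n \<omega> - ?a n \<omega> * ?SWX j n \<omega>) * ?B $ j)"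
      by (simp only: Y' WX X')
    finally have 1: "(sqrt (real n) *\<^sub>R (mu_SRA W Y X n \<omega> - \<mu>)) $ g = \<dots>" .
    have 2: "(\<Sum>i<n. xi_SRA (W i \<omega>, YX i \<omega>) $ g) / sqrt (real n)
      = 1 / \<rho> g * ?SY n \<omega> + (\<Sum>j\<in>UNIV. (?SX j n \<omega> - 1 / \<rho> g * ?SWX j n \<omega>) * \<beta> g $ j)"
    proof -
      have "(\<Sum>i<n. \<Sum>j\<in>UNIV. (dX j (YX i \<omega>) - W i \<omega> $ g * dX j (YX i \<omega>) / \<rho> g) * \<beta> g $ j)
        = (\<Sum>j\<in>UNIV. ((\<Sum>i<n. dX j (YX i \<omega>)) - (\<Sum>i<n. W i \<omega> $ g * dX j (YX i \<omega>)) / \<rho> g) * \<beta> g $ j)"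
        by (subst sum.swap) (simp add: sum_subtractf sum_divide_distrib flip: sum_distrib_right)
      moreover have "(\<Sum>j\<in>UNIV. ((\<Sum>i<n. dX j (YX i \<omega>)) - (\<Sum>i<n. W i \<omega> $ g * dX j (YX i \<omega>)) / \<rho> g) * \<beta> g $ j) / sqrt (real n)
        = (\<Sum>j\<in>UNIV. (?SX j n \<omega> - 1 / \<rho> g * ?SWX j n \<omega>) * \<beta> g $ j)"
        by (subst sum_divide_distrib) (auto intro!: sum.cong simp: diff_divide_distrib left_diff_distrib)
      ultimately show ?thesis
        by (simp add: xi_SRA_def sum.distrib add_divide_distrib flip: sum_divide_distrib)
    qed
    have "?a n \<omega> * ?SY n \<omega> + (\<Sum>j\<in>UNIV. (?SX j n \<omega> - ?a n \<omega> * ?SWX j n \<omega>) * ?B $ j)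
      - (1 / \<rho> g * ?SY n \<omega> + (\<Sum>j\<in>UNIV. (?SX j n \<omega> - 1 / \<rho> g * ?SWX j n \<omega>) * \<beta> g $ j)) = ?R (n, \<omega>)"
    proof -
      have ring: "(sx - a * sw) * b - (sx - r * sw) * b' = (b - b') * sx - (a * b - r * b') * sw"
        for sx a sw b r b' :: real by (simp add: algebra_simps)
      show ?thesis
        unfolding prod.case ring[symmetric] sum_subtractf left_diff_distrib[of "?a n \<omega>"] by linarith
    qed
    then show ?case unfolding x prod.case 1 2 by simp
  qed
qed

definition K :: "'g \<Rightarrow> (real ^ 'g) \<times> (real ^ 'k) \<Rightarrow> real" where
  "K g yx = (\<Sum>j\<in>UNIV. dX j yx * \<beta> g $ j)"

definition U :: "'g \<Rightarrow> (real ^ 'g) \<times> (real ^ 'k) \<Rightarrow> real" where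
  "U g yx = dY g yx - K g yx"

lemma K_measurable [measurable]: "K g \<in> borel_measurable borel"
  unfolding K_def by measurable

lemma U_measurable [measurable]: "U g \<in> borel_measurable borel"
  unfolding U_def by measurable

lemma K_mult: "K g yx * z = (\<Sum>j\<in>UNIV. \<beta> g $ j * (dX j yx * z))"
  unfolding K_def sum_distrib_right by (intro sum.cong) simp_all

lemma dX_K_integrable: "integrable M (\<lambda>\<omega>. dX j (YX 0 \<omega>) * K g (YX 0 \<omega>))"
  using dX_dX_integrable by (simp add: K_def sum_distrib_left flip: mult.assoc)

lemma K_K_integrable: "integrable M (\<lambda>\<omega>. K g (YX 0 \<omega>) * K h (YX 0 \<omega>))"
  unfolding K_mult using dX_K_integrable by simp

lemma dY_dY_integrable: "integrable M (\<lambda>\<omega>. dY g (YX 0 \<omega>) * dY h (YX 0 \<omega>))"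
  by (intro integrable_mult_square_integrable dY_square_integrable) auto

lemma K_dY_integrable: "integrable M (\<lambda>\<omega>. K g (YX 0 \<omega>) * dY h (YX 0 \<omega>))"
  unfolding K_mult using dX_dY_integrable by simp

lemma K_U_integrable: "integrable M (\<lambda>\<omega>. K g (YX 0 \<omega>) * U h (YX 0 \<omega>))"
  using K_K_integrable K_dY_integrable by (simp add: U_def right_diff_distrib)

lemma U_U_integrable: "integrable M (\<lambda>\<omega>. U g (YX 0 \<omega>) * U h (YX 0 \<omega>))"
proof -
  have "U g yx * U h yx = dY g yx * dY h yx - K g yx * dY h yx - K h yx * U g yx" for yx
    by (simp add: U_def algebra_simps)
  then show ?thesis using K_U_integrable K_dY_integrable dY_dY_integrable by simp
qed

lemma dX_U_expectation: "expectation (\<lambda>\<omega>. dX j (YX 0 \<omega>) * U g (YX 0 \<omega>)) = 0"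
proof -
  have "expectation (\<lambda>\<omega>. dX j (YX 0 \<omega>) * U g (YX 0 \<omega>))
    = expectation (\<lambda>\<omega>. dX j (YX 0 \<omega>) * dY g (YX 0 \<omega>)) - expectation (\<lambda>\<omega>. dX j (YX 0 \<omega>) * K g (YX 0 \<omega>))"
    using dX_dY_integrable dX_K_integrable by (simp add: U_def right_diff_distrib)
  also have "expectation (\<lambda>\<omega>. dX j (YX 0 \<omega>) * K g (YX 0 \<omega>)) = (SigmaX M X *v \<beta> g) $ j"
    using dX_dX_integrable
    by (simp add: K_def sum_distrib_left matrix_vector_mult_def dX_dX_expectation flip: mult.assoc)
  also have "\<dots> = expectation (\<lambda>\<omega>. dX j (YX 0 \<omega>) * dY g (YX 0 \<omega>))"
    unfolding SigmaX_beta by simp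
  finally show ?thesis by simp
qed

lemma K_U_expectation: "expectation (\<lambda>\<omega>. K g (YX 0 \<omega>) * U h (YX 0 \<omega>)) = 0"
proof -
  have "integrable M (\<lambda>\<omega>. dX j (YX 0 \<omega>) * U h (YX 0 \<omega>))" for j
    using dX_dY_integrable dX_K_integrable by (simp add: U_def right_diff_distrib)
  then show ?thesis unfolding K_mult by (simp add: dX_U_expectation)
qed

lemma xi_SRA_eq: "xi_SRA (w, yx) $ g = w $ g * U g yx / \<rho> g + K g yx"
  by (simp add: xi_SRA_def U_def K_def left_diff_distrib sum_subtractf sum_divide_distrib
      sum_distrib_left right_diff_distrib diff_divide_distrib mult_ac)

lemma xi_SM_product:
  "integrable M (\<lambda>\<omega>. xi_SM (W 0 \<omega>, YX 0 \<omega>) $ g * xi_SM (W 0 \<omega>, YX 0 \<omega>) $ h)"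
  "expectation (\<lambda>\<omega>. xi_SM (W 0 \<omega>, YX 0 \<omega>) $ g * xi_SM (W 0 \<omega>, YX 0 \<omega>) $ h)
    = (if g = h then expectation (\<lambda>\<omega>. dY g (YX 0 \<omega>) * dY h (YX 0 \<omega>)) / \<rho> g else 0)"
proof -
  have eq: "xi_SM (W 0 \<omega>, YX 0 \<omega>) $ g * xi_SM (W 0 \<omega>, YX 0 \<omega>) $ h
    = W 0 \<omega> $ g * W 0 \<omega> $ h * (dY g (YX 0 \<omega>) * dY h (YX 0 \<omega>)) / (\<rho> g * \<rho> h)" for \<omega>
    by (simp add: xi_SM_def mult_ac)
  have m: "(\<lambda>yx. dY g yx * dY h yx) \<in> borel_measurable borel" by simp
  note WW = WW_mult_YX[OF m dY_dY_integrable, of g h]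
  show "integrable M (\<lambda>\<omega>. xi_SM (W 0 \<omega>, YX 0 \<omega>) $ g * xi_SM (W 0 \<omega>, YX 0 \<omega>) $ h)"
    unfolding eq using WW(1) by simp
  show "expectation (\<lambda>\<omega>. xi_SM (W 0 \<omega>, YX 0 \<omega>) $ g * xi_SM (W 0 \<omega>, YX 0 \<omega>) $ h)
    = (if g = h then expectation (\<lambda>\<omega>. dY g (YX 0 \<omega>) * dY h (YX 0 \<omega>)) / \<rho> g else 0)"
    unfolding eq using WW(2) rho_pos[of g] by simp
qed

lemma xi_SRA_product:
  "integrable M (\<lambda>\<omega>. xi_SRA (W 0 \<omega>, YX 0 \<omega>) $ g * xi_SRA (W 0 \<omega>, YX 0 \<omega>) $ h)"
  "expectation (\<lambda>\<omega>. xi_SRA (W 0 \<omega>, YX 0 \<omega>) $ g * xi_SRA (W 0 \<omega>, YX 0 \<omega>) $ h)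
    = (if g = h then expectation (\<lambda>\<omega>. U g (YX 0 \<omega>) * U h (YX 0 \<omega>)) / \<rho> g else 0)
      + expectation (\<lambda>\<omega>. K g (YX 0 \<omega>) * K h (YX 0 \<omega>))"
proof -
  have eq: "xi_SRA (W 0 \<omega>, YX 0 \<omega>) $ g * xi_SRA (W 0 \<omega>, YX 0 \<omega>) $ h
    = W 0 \<omega> $ g * W 0 \<omega> $ h * (U g (YX 0 \<omega>) * U h (YX 0 \<omega>)) / (\<rho> g * \<rho> h)
      + W 0 \<omega> $ g * (K h (YX 0 \<omega>) * U g (YX 0 \<omega>)) / \<rho> g
      + W 0 \<omega> $ h * (K g (YX 0 \<omega>) * U h (YX 0 \<omega>)) / \<rho> h
      + K g (YX 0 \<omega>) * K h (YX 0 \<omega>)" for \<omega>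
    by (simp add: xi_SRA_eq distrib_left distrib_right mult_ac)
  have m: "(\<lambda>yx. U g yx * U h yx) \<in> borel_measurable borel"
    "(\<lambda>yx. K g yx * U h yx) \<in> borel_measurable borel"
    "(\<lambda>yx. K h yx * U g yx) \<in> borel_measurable borel" by simp_all
  note WW = WW_mult_YX[OF m(1) U_U_integrable, of g h]
    W_mult_YX[OF m(2) K_U_integrable, of h] W_mult_YX[OF m(3) K_U_integrable, of g]
  show "integrable M (\<lambda>\<omega>. xi_SRA (W 0 \<omega>, YX 0 \<omega>) $ g * xi_SRA (W 0 \<omega>, YX 0 \<omega>) $ h)"
    unfolding eq using WW K_K_integrable by simp
  show "expectation (\<lambda>\<omega>. xi_SRA (W 0 \<omega>, YX 0 \<omega>) $ g * xi_SRA (W 0 \<omega>, YX 0 \<omega>) $ h)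
    = (if g = h then expectation (\<lambda>\<omega>. U g (YX 0 \<omega>) * U h (YX 0 \<omega>)) / \<rho> g else 0)
      + expectation (\<lambda>\<omega>. K g (YX 0 \<omega>) * K h (YX 0 \<omega>))"
    unfolding eq using WW K_K_integrable rho_pos[of g] by (simp add: K_U_expectation)
qed

lemma xi_SM_mean: "expectation (\<lambda>\<omega>. xi_SM (W 0 \<omega>, YX 0 \<omega>) $ g) = 0"
  using W_mult_YX(2)[OF dY_measurable dY_integrable, of g g] by (simp add: xi_SM_def dY_mean)

lemma K_integrable: "integrable M (\<lambda>\<omega>. K g (YX 0 \<omega>))"
  using dX_integrable by (simp add: K_def)

lemma K_mean: "expectation (\<lambda>\<omega>. K g (YX 0 \<omega>)) = 0"
  using dX_integrable by (simp add: K_def dX_mean)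

lemma xi_SRA_mean: "expectation (\<lambda>\<omega>. xi_SRA (W 0 \<omega>, YX 0 \<omega>) $ g) = 0"
proof -
  have "integrable M (\<lambda>\<omega>. U g (YX 0 \<omega>))" "expectation (\<lambda>\<omega>. U g (YX 0 \<omega>)) = 0"
    using dY_integrable K_integrable by (simp_all add: U_def dY_mean K_mean)
  then show ?thesis
    using W_mult_YX[OF U_measurable, of g g] K_integrable by (simp add: xi_SRA_eq K_mean)
qed

lemma is_avar_SM:
  "is_avar M (\<lambda>N \<omega>. sqrt (real N) *\<^sub>R (mu_SM W Y N \<omega> - \<mu>))
    (\<chi> g h. if g = h then expectation (\<lambda>\<omega>. dY g (YX 0 \<omega>) * dY h (YX 0 \<omega>)) / \<rho> g else 0)"
proof -
  have "integrable M (\<lambda>\<omega>. (xi_SM (W 0 \<omega>, YX 0 \<omega>) $ g)\<^sup>2)" for g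
    using xi_SM_product(1)[of g g] by (simp add: power2_eq_square)
  moreover have "(\<lambda>\<omega>. sqrt (real n) *\<^sub>R (mu_SM W Y n \<omega> - \<mu>)) \<in> borel_measurable M" for n
    by measurable
  ultimately show ?thesis
    using is_avar_asymptotically_linear[OF xi_SM_measurable _ xi_SM_mean _ SM_asymptotically_linear]
    unfolding xi_SM_product(2) by blast
qed

lemma is_avar_SRA:
  "is_avar M (\<lambda>N \<omega>. sqrt (real N) *\<^sub>R (mu_SRA W Y X N \<omega> - \<mu>))
    (\<chi> g h. (if g = h then expectation (\<lambda>\<omega>. U g (YX 0 \<omega>) * U h (YX 0 \<omega>)) / \<rho> g else 0)
      + expectation (\<lambda>\<omega>. K g (YX 0 \<omega>) * K h (YX 0 \<omega>)))"
proof -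
  have "integrable M (\<lambda>\<omega>. (xi_SRA (W 0 \<omega>, YX 0 \<omega>) $ g)\<^sup>2)" for g
    using xi_SRA_product(1)[of g g] by (simp add: power2_eq_square)
  moreover have "(\<lambda>\<omega>. sqrt (real n) *\<^sub>R (mu_SRA W Y X n \<omega> - \<mu>)) \<in> borel_measurable M" for n
    by measurable
  ultimately show ?thesis
    using is_avar_asymptotically_linear[OF xi_SRA_measurable _ xi_SRA_mean _ SRA_asymptotically_linear]
    unfolding xi_SRA_product(2) by blast
qed

lemma Kvec_eq: "Kvec M Y X 0 \<omega> $ g = K g (YX 0 \<omega>)"
  by (simp add: Kvec_def K_def Xdot_def dX_def inner_vec_def)

lemma OmegaK_eq: "OmegaK M Y X = (\<chi> g h. expectation (\<lambda>\<omega>. K g (YX 0 \<omega>) * K h (YX 0 \<omega>)))"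
  by (simp add: OmegaK_def Kvec_eq)

lemma OmegaL_eq: "OmegaL M W Y X =
  (\<chi> g h. if g = h then expectation (\<lambda>\<omega>. K g (YX 0 \<omega>) * K h (YX 0 \<omega>)) / \<rho> g else 0)"
proof -
  have "Lvec M W Y X 0 \<omega> $ g = W 0 \<omega> $ g * K g (YX 0 \<omega>) / \<rho> g" for \<omega> g
    by (simp add: Lvec_def K_def Xdot_def dX_def inner_vec_def)
  then have eq: "Lvec M W Y X 0 \<omega> $ g * Lvec M W Y X 0 \<omega> $ h
    = W 0 \<omega> $ g * W 0 \<omega> $ h * (K g (YX 0 \<omega>) * K h (YX 0 \<omega>)) / (\<rho> g * \<rho> h)" for \<omega> g h
    by (simp add: mult_ac)
  have m: "(\<lambda>yx. K g yx * K h yx) \<in> borel_measurable borel" for g h by simp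
  show ?thesis
    unfolding OmegaL_def eq using WW_mult_YX(2)[OF m K_K_integrable] rho_pos
    by (simp add: vec_eq_iff less_imp_neq[symmetric])
qed

lemma dY_dY_expectation:
  "expectation (\<lambda>\<omega>. dY g (YX 0 \<omega>) * dY g (YX 0 \<omega>))
    = expectation (\<lambda>\<omega>. U g (YX 0 \<omega>) * U g (YX 0 \<omega>)) + expectation (\<lambda>\<omega>. K g (YX 0 \<omega>) * K g (YX 0 \<omega>))"
proof -
  have "dY g yx * dY g yx = U g yx * U g yx + K g yx * K g yx + 2 * (K g yx * U g yx)" for yx
    by (simp add: U_def algebra_simps)
  then show ?thesis
    using U_U_integrable K_K_integrable K_U_integrable by (simp add: K_U_expectation)
qed

text \<open>Cauchy--Schwarz with the weights \<open>\<rho>\<close>, which sum to 1.\<close>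

lemma psd_OmegaL_minus_OmegaK: "psd (OmegaL M W Y X - OmegaK M Y X)"
  unfolding psd_def
proof
  fix c :: "real ^ 'g"
  have L: "c \<bullet> (OmegaL M W Y X *v c) = expectation (\<lambda>\<omega>. \<Sum>g\<in>UNIV. (c $ g)\<^sup>2 / \<rho> g * (K g (YX 0 \<omega>) * K g (YX 0 \<omega>)))"
    using K_K_integrable
    by (simp add: OmegaL_eq inner_vec_def matrix_vector_mult_def mult_delta_left mult_delta_right power2_eq_square mult_ac)
  have sq: "(\<Sum>g\<in>UNIV. c $ g * K g yx)\<^sup>2 = (\<Sum>g\<in>UNIV. \<Sum>h\<in>UNIV. c $ g * c $ h * (K g yx * K h yx))" for yx
    by (simp add: power2_eq_square sum_product mult_ac)
  have K: "c \<bullet> (OmegaK M Y X *v c) = expectation (\<lambda>\<omega>. (\<Sum>g\<in>UNIV. c $ g * K g (YX 0 \<omega>))\<^sup>2)"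
    unfolding sq using K_K_integrable
    by (simp add: OmegaK_eq inner_vec_def matrix_vector_mult_def sum_distrib_left mult_ac)
  have "expectation (\<lambda>\<omega>. (\<Sum>g\<in>UNIV. c $ g * K g (YX 0 \<omega>))\<^sup>2)
    \<le> expectation (\<lambda>\<omega>. \<Sum>g\<in>UNIV. (c $ g)\<^sup>2 / \<rho> g * (K g (YX 0 \<omega>) * K g (YX 0 \<omega>)))"
  proof (rule integral_mono)
    show "integrable M (\<lambda>\<omega>. (\<Sum>g\<in>UNIV. c $ g * K g (YX 0 \<omega>))\<^sup>2)"
      unfolding sq using K_K_integrable by simp
    show "integrable M (\<lambda>\<omega>. \<Sum>g\<in>UNIV. (c $ g)\<^sup>2 / \<rho> g * (K g (YX 0 \<omega>) * K g (YX 0 \<omega>)))"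
      using K_K_integrable by simp
    fix \<omega>
    let ?k = "\<lambda>g. c $ g * K g (YX 0 \<omega>)"
    have "(\<Sum>g\<in>UNIV. ?k g)\<^sup>2 = (\<Sum>g\<in>UNIV. sqrt (\<rho> g) * (?k g / sqrt (\<rho> g)))\<^sup>2"
      using rho_pos by (simp add: less_imp_neq[symmetric])
    also have "\<dots> \<le> (\<Sum>g\<in>UNIV. (sqrt (\<rho> g))\<^sup>2) * (\<Sum>g\<in>UNIV. (?k g / sqrt (\<rho> g))\<^sup>2)"
      by (rule Cauchy_Schwarz_ineq_sum)
    also have "\<dots> = (\<Sum>g\<in>UNIV. (c $ g)\<^sup>2 / \<rho> g * (K g (YX 0 \<omega>) * K g (YX 0 \<omega>)))"
      using rho_pos sum_rho by (simp add: less_imp_le power_divide power_mult_distrib power2_eq_square mult_ac)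
    finally show "(\<Sum>g\<in>UNIV. ?k g)\<^sup>2 \<le> (\<Sum>g\<in>UNIV. (c $ g)\<^sup>2 / \<rho> g * (K g (YX 0 \<omega>) * K g (YX 0 \<omega>)))" .
  qed
  then show "0 \<le> c \<bullet> ((OmegaL M W Y X - OmegaK M Y X) *v c)"
    by (simp add: matrix_vector_mult_diff_rdistrib inner_diff_right L K)
qed

end

theorem theorem4:
  fixes M :: "'a measure"
    and W :: "nat \<Rightarrow> 'a \<Rightarrow> real ^ 'g"
    and Y :: "nat \<Rightarrow> 'a \<Rightarrow> real ^ 'g"
    and X :: "nat \<Rightarrow> 'a \<Rightarrow> real ^ 'k"
  assumes P: "prob_space M"
    and G2: "CARD('g) \<ge> 2"
    and measW: "\<And>i. W i \<in> borel_measurable M"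
    and measY: "\<And>i. Y i \<in> borel_measurable M"
    and measX: "\<And>i. X i \<in> borel_measurable M"
    and W01: "\<And>i \<omega> g. \<omega> \<in> space M \<Longrightarrow> W i \<omega> $ g \<in> {0, 1}"
    and Wsum: "\<And>i \<omega>. \<omega> \<in> space M \<Longrightarrow> (\<Sum>g\<in>UNIV. W i \<omega> $ g) = 1"
    and rho_pos: "\<And>g. rho M W g > 0"
    and indepWYX: "prob_space.indep_set M
                   {W 0 -` A \<inter> space M | A. A \<in> sets borel}
                   {(\<lambda>\<omega>. (Y 0 \<omega>, X 0 \<omega>)) -` B \<inter> space M | B. B \<in> sets borel}"
    and iid_indep: "prob_space.indep_vars M (\<lambda>_. borel) (\<lambda>i \<omega>. (W i \<omega>, Y i \<omega>, X i \<omega>)) UNIV"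
    and iid_ident: "\<And>i. distr M borel (\<lambda>\<omega>. (W i \<omega>, Y i \<omega>, X i \<omega>))
                        = distr M borel (\<lambda>\<omega>. (W 0 \<omega>, Y 0 \<omega>, X 0 \<omega>))"
    and momY: "\<And>g. integrable M (\<lambda>\<omega>. (Y 0 \<omega> $ g)\<^sup>2)"
    and momX: "\<And>k. integrable M (\<lambda>\<omega>. (X 0 \<omega> $ k)\<^sup>2)"
    and SigmaX_inv: "invertible (SigmaX M X)"
  shows "\<exists>V_SM V_SRA.
           is_avar M (\<lambda>N \<omega>. sqrt (real N) *\<^sub>R (mu_SM W Y N \<omega> - mu M Y)) V_SM \<and>
           is_avar M (\<lambda>N \<omega>. sqrt (real N) *\<^sub>R (mu_SRA W Y X N \<omega> - mu M Y)) V_SRA \<and>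
           V_SM - V_SRA = OmegaL M W Y X - OmegaK M Y X \<and>
           psd (V_SM - V_SRA)"
proof -
  interpret randomized_experiment M W Y X
    by (intro randomized_experiment.intro randomized_experiment_axioms.intro) fact+
  let ?V_SM = "\<chi> g h. if g = h then expectation (\<lambda>\<omega>. dY g (YX 0 \<omega>) * dY h (YX 0 \<omega>)) / \<rho> g else 0"
  let ?V_SRA = "\<chi> g h. (if g = h then expectation (\<lambda>\<omega>. U g (YX 0 \<omega>) * U h (YX 0 \<omega>)) / \<rho> g else 0)
      + expectation (\<lambda>\<omega>. K g (YX 0 \<omega>) * K h (YX 0 \<omega>))"
  have "?V_SM - ?V_SRA = OmegaL M W Y X - OmegaK M Y X"
    by (simp add: vec_eq_iff OmegaL_eq OmegaK_eq dY_dY_expectation add_divide_distrib)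
  then show ?thesis
    using is_avar_SM is_avar_SRA psd_OmegaL_minus_OmegaK
    by (intro exI[of _ ?V_SM] exI[of _ ?V_SRA]) simp
qed

end
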